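(* Let $X$ be an infinite-dimensional $L_1$-predual. If there is $e^*\in\mathrm{ext}(B_{X^*})$ which is the weak-star limit of a net $\{e^*_\lambda\}$ of pairwise linearly independent elements of $\mathrm{ext}(B_{X^*})$, then $X$ has the convex-DLD2P. In the real case, the previous condition can be replaced with $[\mathrm{ext}(B_{X^*})]'\cap\mathrm{ext}(B_{X^*})\neq\emptyset$.
   Context: Banach spaces are over $\mathbb{R}$ or $\mathbb{C}$; $B_X$, $S_X$ are the closed unit ball and unit sphere; $\mathrm{ext}(C)$ is the set of extreme points of $C$; $A'$ is the set of weak-star accumulation points of $A\subseteq X^*$. An $L_1$-predual is a Banach space whose dual is isometrically isomorphic to $L_1(\mu)$ for some positive measure $\mu$. A point $x\in S_X$ is a $\Delta$-point if for every $\varepsilon>0$ and every slice $S$ of $B_X$ containing $x$ (a slice being a set $\{y\in B_X\colon \mathrm{Re}\,x^*(y)>\sup\mathrm{Re}\,x^*(B_X)-\alpha\}$ with $x^*\in X^*$, $\alpha>0$) there is $y\in S$ with $\|x-y\|>2-\varepsilon$. $X$ has the convex diametral local diameter two property (convex-DLD2P) if $B_X=\overline{\mathrm{conv}}(\Delta_X)$, where $\Delta_X$ is the set of $\Delta$-points of $S_X$. A net of pairwise linearly independent elements means that $e^*_\lambda$ and $e^*_{\lambda'}$ are linearly independent whenever $\lambda\ne\lambda'$; the directed index set is understood to have no greatest element (so that the convergence is not trivial). *)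

theory Defs
  imports "HOL-Analysis.Analysis"
begin

text \<open>
  The scalar fields. Both \<^typ>\<open>real\<close> and \<^typ>\<open>complex\<close> are instances, and the axiom says that there
  is no other one up to isomorphism: the field is \<open>\<real> + \<real>i\<close> with \<open>i = 0\<close> or \<open>i\<^sup>2 = -1\<close>.
\<close>

class real_or_complex = real_normed_field + euclidean_space +
  assumes real_or_complex:
    "\<exists>i. (i = 0 \<or> i * i = - 1) \<and> (\<forall>z. \<exists>a b. z = a *\<^sub>R 1 + b *\<^sub>R i)"

instance real :: real_or_complex
  by standard (rule exI [of _ 0], simp)

instance complex :: real_or_complex
proof
  have "z = Re z *\<^sub>R 1 + Im z *\<^sub>R \<i>" for z
    by (simp add: complex_eq_iff)
  then have "\<forall>z. \<exists>a b. z = a *\<^sub>R 1 + b *\<^sub>R \<i>"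
    by blast
  then show "\<exists>i::complex. (i = 0 \<or> i * i = - 1) \<and> (\<forall>z. \<exists>a b. z = a *\<^sub>R 1 + b *\<^sub>R i)"
    by (intro exI [of _ "\<i>"] conjI disjI2) (simp, assumption)
qed

definition scalar_Re :: "'k::real_or_complex \<Rightarrow> real"
  where "scalar_Re z = z \<bullet> 1"

lemma scalar_Re_real [simp]: "scalar_Re (x::real) = x"
  by (simp add: scalar_Re_def)

lemma scalar_Re_complex [simp]: "scalar_Re (z::complex) = Re z"
  by (simp add: scalar_Re_def inner_complex_def)

text \<open>
  A Banach space over \<open>'k\<close>: the class \<^class>\<open>banach\<close> provides the complete norm and the underlying
  real vector space, the argument is the multiplication by scalars from \<open>'k\<close>.
\<close>

definition banach_space_over :: "('k::real_or_complex \<Rightarrow> 'a::banach \<Rightarrow> 'a) \<Rightarrow> bool"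
  where "banach_space_over smul \<longleftrightarrow>
    vector_space smul \<and>
    (\<forall>r x. smul (of_real r) x = r *\<^sub>R x) \<and>
    (\<forall>c x. norm (smul c x) = norm c * norm x)"

lemma banach_space_over_scaleR: "banach_space_over (scaleR :: real \<Rightarrow> 'a::banach \<Rightarrow> 'a)"
  by (simp add: banach_space_over_def vector_space_def scaleR_add_right scaleR_add_left)

definition infinite_dimensional :: "('k::real_or_complex \<Rightarrow> 'a::banach \<Rightarrow> 'a) \<Rightarrow> bool"
  where "infinite_dimensional smul \<longleftrightarrow> \<not> (\<exists>B. finite B \<and> module.span smul B = UNIV)"

text \<open>
  The members of \<^typ>\<open>'a \<Rightarrow>\<^sub>L 'k\<close> are only real-linear, so the dual consists of those which commute with
  scalars. Its norm is the operator norm of \<^typ>\<open>'a \<Rightarrow>\<^sub>L 'k\<close>.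
\<close>

definition dual_space :: "('k::real_or_complex \<Rightarrow> 'a::banach \<Rightarrow> 'a) \<Rightarrow> ('a \<Rightarrow>\<^sub>L 'k) set"
  where "dual_space smul = {f :: 'a \<Rightarrow>\<^sub>L 'k. \<forall>c x. f (smul c x) = c * f x}"

definition dual_ball :: "('k::real_or_complex \<Rightarrow> 'a::banach \<Rightarrow> 'a) \<Rightarrow> ('a \<Rightarrow>\<^sub>L 'k) set"
  where "dual_ball smul = dual_space smul \<inter> cball 0 1"

definition ext_dual_ball :: "('k::real_or_complex \<Rightarrow> 'a::banach \<Rightarrow> 'a) \<Rightarrow> ('a \<Rightarrow>\<^sub>L 'k) set"
  where "ext_dual_ball smul = {f. f extreme_point_of dual_ball smul}"

definition dual_scale :: "'k::real_or_complex \<Rightarrow> ('a::banach \<Rightarrow>\<^sub>L 'k) \<Rightarrow> ('a \<Rightarrow>\<^sub>L 'k)"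
  where "dual_scale c f = blinfun_mult_right c o\<^sub>L f"

lemma dual_scale_apply [simp]: "dual_scale c f x = c * f x"
  by (simp add: dual_scale_def)

definition linearly_independent_pair :: "('a::banach \<Rightarrow>\<^sub>L 'k::real_or_complex) \<Rightarrow> ('a \<Rightarrow>\<^sub>L 'k) \<Rightarrow> bool"
  where "linearly_independent_pair f g \<longleftrightarrow>
    (\<forall>a b. dual_scale a f + dual_scale b g = 0 \<longrightarrow> a = 0 \<and> b = 0)"

text \<open>
  For scalar-valued functionals the strong operator topology is the topology of pointwise
  convergence on \<open>'a\<close>.
\<close>

definition weak_star_topology :: "('k::real_or_complex \<Rightarrow> 'a::banach \<Rightarrow> 'a) \<Rightarrow> ('a \<Rightarrow>\<^sub>L 'k) topology"
  where "weak_star_topology smul = subtopology strong_operator_topology (dual_space smul)"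

text \<open>
  \<open>X\<^sup>*\<close> is isometrically isomorphic to \<open>L\<^sub>1(M)\<close>. An element of \<open>L\<^sub>1(M)\<close> is given by an integrable
  representative, so that equality in \<open>L\<^sub>1(M)\<close> is equality almost everywhere. The five conditions
  say that \<open>T\<close> maps into \<open>L\<^sub>1(M)\<close>, is additive, homogeneous, isometric, and onto. No finiteness
  assumption is made on \<open>M\<close>.
\<close>

definition L1_predual :: "('k::real_or_complex \<Rightarrow> 'a::banach \<Rightarrow> 'a) \<Rightarrow> 'm measure \<Rightarrow> bool"
  where "L1_predual smul M \<longleftrightarrow>
    (\<exists>T :: ('a \<Rightarrow>\<^sub>L 'k) \<Rightarrow> 'm \<Rightarrow> 'k.
      (\<forall>f\<in>dual_space smul. integrable M (T f)) \<and>
      (\<forall>f\<in>dual_space smul. \<forall>g\<in>dual_space smul. AE t in M. T (f + g) t = T f t + T g t) \<and>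
      (\<forall>c. \<forall>f\<in>dual_space smul. AE t in M. T (dual_scale c f) t = c * T f t) \<and>
      (\<forall>f\<in>dual_space smul. (\<integral>t. norm (T f t) \<partial>M) = norm f) \<and>
      (\<forall>h. integrable M h \<longrightarrow> (\<exists>f\<in>dual_space smul. AE t in M. T f t = h t)))"

definition directed_without_greatest :: "'i set \<Rightarrow> ('i \<Rightarrow> 'i \<Rightarrow> bool) \<Rightarrow> bool"
  where "directed_without_greatest I le \<longleftrightarrow>
    I \<noteq> {} \<and>
    (\<forall>i\<in>I. le i i) \<and>
    (\<forall>i\<in>I. \<forall>j\<in>I. \<forall>k\<in>I. le i j \<longrightarrow> le j k \<longrightarrow> le i k) \<and>
    (\<forall>i\<in>I. \<forall>j\<in>I. \<exists>k\<in>I. le i k \<and> le j k) \<and>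
    \<not> (\<exists>m\<in>I. \<forall>i\<in>I. le i m)"

definition net_filter :: "'i set \<Rightarrow> ('i \<Rightarrow> 'i \<Rightarrow> bool) \<Rightarrow> 'i filter"
  where "net_filter I le = (INF i\<in>I. principal {j\<in>I. le i j})"

lemma eventually_net_filter:
  assumes "directed_without_greatest I le"
  shows "eventually P (net_filter I le) \<longleftrightarrow> (\<exists>i\<in>I. \<forall>j\<in>I. le i j \<longrightarrow> P j)"
proof -
  have refl: "i \<in> I \<Longrightarrow> le i i"
    and le_trans: "i \<in> I \<Longrightarrow> j \<in> I \<Longrightarrow> k \<in> I \<Longrightarrow> le i j \<Longrightarrow> le j k \<Longrightarrow> le i k"
    and dir: "i \<in> I \<Longrightarrow> j \<in> I \<Longrightarrow> \<exists>k\<in>I. le i k \<and> le j k"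
    and ne: "I \<noteq> {}" for i j k
    using assms unfolding directed_without_greatest_def by metis+
  have base: "\<exists>k\<in>I. principal {l\<in>I. le k l} \<le> inf (principal {l\<in>I. le i l}) (principal {l\<in>I. le j l})"
    if ij: "i \<in> I" "j \<in> I" for i j
  proof -
    obtain k where k: "k \<in> I" "le i k" "le j k"
      using dir [OF ij] by blast
    have "{l\<in>I. le k l} \<subseteq> {l\<in>I. le i l} \<inter> {l\<in>I. le j l}"
      using le_trans [OF ij(1) k(1) _ k(2)] le_trans [OF ij(2) k(1) _ k(3)] by blast
    then show ?thesis
      using k(1) by (intro bexI [of _ k]) simp_all
  qed
  have "eventually P (net_filter I le) \<longleftrightarrow> (\<exists>i\<in>I. eventually P (principal {l\<in>I. le i l}))"
    unfolding net_filter_def by (rule eventually_INF_base [OF ne base])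
  then show ?thesis
    unfolding eventually_principal by blast
qed

definition ball_slice ::
    "('k::real_or_complex \<Rightarrow> 'a::banach \<Rightarrow> 'a) \<Rightarrow> ('a \<Rightarrow>\<^sub>L 'k) \<Rightarrow> real \<Rightarrow> 'a set"
  where "ball_slice smul f \<alpha> =
    {y \<in> cball 0 1. scalar_Re (f y) > (SUP z\<in>cball 0 1. scalar_Re (f z)) - \<alpha>}"

definition Delta_points :: "('k::real_or_complex \<Rightarrow> 'a::banach \<Rightarrow> 'a) \<Rightarrow> 'a set"
  where "Delta_points smul =
    {x \<in> sphere 0 1. \<forall>\<epsilon>>0. \<forall>f\<in>dual_space smul. \<forall>\<alpha>>0. x \<in> ball_slice smul f \<alpha> \<longrightarrow>
      (\<exists>y\<in>ball_slice smul f \<alpha>. norm (x - y) > 2 - \<epsilon>)}"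

definition convex_DLD2P :: "('k::real_or_complex \<Rightarrow> 'a::banach \<Rightarrow> 'a) \<Rightarrow> bool"
  where "convex_DLD2P smul \<longleftrightarrow> cball 0 1 = closure (convex hull (Delta_points smul))"

end

theory Submission
  imports Defs
begin

text \<open>
  In \<open>L\<^sub>1(\<mu>)\<close> an extreme point of the unit ball is a normalised function supported on an atom. Hence
  every extreme point \<open>e\<close> of the dual ball of an \<open>L\<^sub>1\<close>-predual \<open>X\<close> spans an L-summand: each functional
  \<open>f\<close> splits as \<open>a e + h\<close> in such a way that \<open>\<parallel>b e + c h\<parallel> = \<bar>b\<bar> + \<bar>c\<bar> \<parallel>h\<parallel>\<close> for all scalars
  (\<open>L_coordinate_exists\<close>). Dually, the value at \<open>e\<close> is an independent coordinate of a point of the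
  bidual: it may be changed to any scalar of modulus at most \<open>1\<close> without leaving the unit ball and
  without changing the values at the complementary parts \<open>h\<close>. In \<open>X\<close> itself this survives up to
  arbitrarily small errors, in one version that respects two balls and in one that respects the value
  at a single functional.

  The first version (\<open>L_summand_replace_coordinate\<close>, by Hahn-Banach separation in \<open>X \<times> X\<close>) together with
  an iteration that removes the error (\<open>L_summand_norm_one_correction\<close>) shows that the points \<open>x\<close> of the
  unit sphere with \<open>\<bar>e x\<bar> = 1\<close> have the whole ball as their closed convex hull: if \<open>z\<close> is in
  the ball and \<open>e z = \<bar>e z\<bar> \<theta>\<close> with \<open>\<theta>\<close> unimodular, then \<open>z\<close> is approximated by convex combinations of two
  points of the ball at which \<open>e\<close> has the values \<open>\<theta>\<close> and \<open>- \<theta>\<close> (\<open>cball_subset_closure_hull_face\<close>).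

  The second version (\<open>L_coordinate_approximation\<close>) shows that each such \<open>x\<close> is a \<open>\<Delta>\<close>-point as soon as
  \<open>e\<close> is approximated, at \<open>x\<close>, by infinitely many pairwise independent extreme points. These live on
  disjoint atoms, so a given functional \<open>f\<close> has a small coordinate \<open>a\<close> along one of them, say \<open>g\<close>
  (\<open>small_L_coordinate\<close>). Changing the coordinate of \<open>x\<close> at \<open>g\<close> from \<open>g x\<close> to \<open>- g x\<close> moves \<open>f x\<close> only by
  about \<open>2 \<bar>a\<bar>\<close>, so the new point stays in a given slice defined by \<open>f\<close>, but it has distance about
  \<open>2 \<bar>g x\<bar>\<close>, hence about \<open>2\<close>, from \<open>x\<close>.

  A tail of a net of pairwise independent elements without greatest index provides the required
  infinite family. For real scalars every weak-star neighbourhood of an accumulation point contains one, because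
  dependent extreme points differ only by a sign, and \<open>g\<close> and \<open>- g\<close> cannot both be close to \<open>e\<close> at a point where \<open>\<bar>e x\<bar> = 1\<close>.
\<close>

section \<open>Sublinear functionals and Hahn-Banach separation\<close>

definition sublinear :: "('v::real_vector \<Rightarrow> real) \<Rightarrow> bool"
  where "sublinear p \<longleftrightarrow>
    (\<forall>x y. p (x + y) \<le> p x + p y) \<and> (\<forall>t\<ge>0. \<forall>x. p (t *\<^sub>R x) = t * p x)"

lemma sublinearI:
  assumes "\<And>x y. p (x + y) \<le> p x + p y"
    and "p 0 = 0" and "\<And>t x. t > 0 \<Longrightarrow> p (t *\<^sub>R x) \<le> t * p x"
  shows "sublinear p"
proof -
  have "p (t *\<^sub>R x) = t * p x" if "t > 0" for t x
  proof (rule antisym)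
    have "p (inverse t *\<^sub>R (t *\<^sub>R x)) \<le> inverse t * p (t *\<^sub>R x)"
      using that by (intro assms(3)) simp
    then show "t * p x \<le> p (t *\<^sub>R x)"
      using that by (simp add: field_simps)
  qed (use assms(3) that in blast)
  then have "p (t *\<^sub>R x) = t * p x" if "t \<ge> 0" for t x
    using that assms(2) by (cases "t = 0") auto
  then show ?thesis
    using assms(1) by (auto simp: sublinear_def)
qed

lemma sublinear_add: "sublinear p \<Longrightarrow> p (x + y) \<le> p x + p y"
  and sublinear_scale: "sublinear p \<Longrightarrow> t \<ge> 0 \<Longrightarrow> p (t *\<^sub>R x) = t * p x"
  by (auto simp: sublinear_def)

lemma sublinear_zero: "sublinear p \<Longrightarrow> p 0 = 0"
  using sublinear_scale [of p 0 0] by simp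

lemma sublinear_ge: "sublinear p \<Longrightarrow> - p (- x) \<le> p x"
  using sublinear_add [of p x "- x"] sublinear_zero [of p] by simp

text \<open>
  The functional \<open>p z = inf {q (z + t v) - t c | t \<ge> 0, v \<in> V}\<close> does it. Convexity of \<open>V\<close> gives
  subadditivity, and the bound \<open>c \<le> q v\<close> keeps the infimum above \<open>- q (- z)\<close>. Any linear functional
  below \<open>p\<close> is then at least \<open>c\<close> on \<open>V\<close>. The construction is used twice, for a singleton \<open>V\<close> in
  showing that minimal sublinear functionals are linear, and for the separation theorem itself.
\<close>

lemma sublinear_shrink:
  fixes q :: "'v::real_vector \<Rightarrow> real"
  assumes q: "sublinear q" and V: "convex V" "V \<noteq> {}" and c: "\<And>v. v \<in> V \<Longrightarrow> c \<le> q v"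
  obtains p where "sublinear p" "\<And>z. p z \<le> q z" "\<And>v. v \<in> V \<Longrightarrow> p (- v) \<le> - c"
proof -
  define S where "S z = {q (z + t *\<^sub>R v) - t * c | t v. t \<ge> 0 \<and> v \<in> V}" for z
  define p where "p z = Inf (S z)" for z
  have SI: "q (z + t *\<^sub>R v) - t * c \<in> S z" if "t \<ge> 0" "v \<in> V" for z t v
    using that by (auto simp: S_def)
  have ne: "S z \<noteq> {}" for z
    using V(2) SI [of 0] by blast
  have lower: "- q (- z) \<le> a" if "a \<in> S z" for a z
  proof -
    obtain t v where tv: "t \<ge> 0" "v \<in> V" and a: "a = q (z + t *\<^sub>R v) - t * c"
      using \<open>a \<in> S z\<close> by (auto simp: S_def)
    have "q (t *\<^sub>R v) \<le> q (z + t *\<^sub>R v) + q (- z)"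
      using sublinear_add [OF q, of "z + t *\<^sub>R v" "- z"] by simp
    moreover have "t * c \<le> q (t *\<^sub>R v)"
      using c tv q by (simp add: sublinear_scale mult_left_mono)
    ultimately show ?thesis
      using a by simp
  qed
  have bdd: "bdd_below (S z)" for z
    using lower by (meson bdd_belowI)
  have p_le: "p z \<le> q (z + t *\<^sub>R v) - t * c" if "t \<ge> 0" "v \<in> V" for z t v
    unfolding p_def using SI [OF that] bdd by (rule cInf_lower)
  have le: "p z \<le> q z" for z
    using p_le [of 0] V(2) by auto
  show thesis
  proof
    show "p z \<le> q z" for z
      by (rule le)
    show "p (- v) \<le> - c" if "v \<in> V" for v
      using p_le [of 1 v "- v"] that sublinear_zero [OF q] by simp
    show "sublinear p"
    proof (rule sublinearI)
      fix x y
      have *: "p (x + y) \<le> a + b" if ab: "a \<in> S x" "b \<in> S y" for a b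
      proof -
        obtain t v where tv: "t \<ge> 0" "v \<in> V" and a: "a = q (x + t *\<^sub>R v) - t * c"
          using ab by (auto simp: S_def)
        obtain r w where rw: "r \<ge> 0" "w \<in> V" and b: "b = q (y + r *\<^sub>R w) - r * c"
          using ab by (auto simp: S_def)
        obtain u where u: "u \<in> V" "(t + r) *\<^sub>R u = t *\<^sub>R v + r *\<^sub>R w"
        proof (cases "t + r = 0")
          case True
          then show thesis
            using tv rw that [of v] by (simp add: add_nonneg_eq_0_iff)
        next
          case False
          then have "t + r > 0"
            using tv rw by simp
          then have "(t / (t + r)) *\<^sub>R v + (r / (t + r)) *\<^sub>R w \<in> V"
            using tv rw by (intro convexD [OF V(1)]) (auto simp flip: add_divide_distrib)
          moreover have "(t + r) *\<^sub>R ((t / (t + r)) *\<^sub>R v + (r / (t + r)) *\<^sub>R w) = t *\<^sub>R v + r *\<^sub>R w"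
            using \<open>t + r > 0\<close> by (simp add: scaleR_add_right)
          ultimately show thesis
            using that by blast
        qed
        have "p (x + y) \<le> q (x + y + (t + r) *\<^sub>R u) - (t + r) * c"
          using tv rw u by (intro p_le) auto
        also have "x + y + (t + r) *\<^sub>R u = (x + t *\<^sub>R v) + (y + r *\<^sub>R w)"
          by (simp add: u(2))
        also have "q \<dots> \<le> q (x + t *\<^sub>R v) + q (y + r *\<^sub>R w)"
          by (rule sublinear_add [OF q])
        finally show ?thesis
          by (simp add: a b algebra_simps)
      qed
      have "p (x + y) - a \<le> p y" if "a \<in> S x" for a
        unfolding p_def [of y] using * [OF that] ne by (intro cInf_greatest) (auto simp: algebra_simps)
      then have "p (x + y) - p y \<le> p x"
        unfolding p_def [of x] using ne by (intro cInf_greatest) (auto simp: algebra_simps)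
      then show "p (x + y) \<le> p x + p y"
        by simp
    next
      have "0 \<le> p 0"
        unfolding p_def using lower [of _ 0] ne sublinear_zero [OF q] by (intro cInf_greatest) auto
      then show "p 0 = 0"
        using le [of 0] sublinear_zero [OF q] by simp
    next
      fix r :: real and x
      assume r: "r > 0"
      have "p (r *\<^sub>R x) / r \<le> a" if "a \<in> S x" for a
      proof -
        obtain t v where tv: "t \<ge> 0" "v \<in> V" and a: "a = q (x + t *\<^sub>R v) - t * c"
          using \<open>a \<in> S x\<close> by (auto simp: S_def)
        have "p (r *\<^sub>R x) \<le> q (r *\<^sub>R x + (r * t) *\<^sub>R v) - (r * t) * c"
          using tv r by (intro p_le) auto
        also have "r *\<^sub>R x + (r * t) *\<^sub>R v = r *\<^sub>R (x + t *\<^sub>R v)"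
          by (simp add: scaleR_add_right)
        also have "q \<dots> = r * q (x + t *\<^sub>R v)"
          using r q by (simp add: sublinear_scale)
        finally show ?thesis
          using r by (simp add: a field_simps)
      qed
      then have "p (r *\<^sub>R x) / r \<le> p x"
        unfolding p_def [of x] using ne by (intro cInf_greatest) auto
      then show "p (r *\<^sub>R x) \<le> r * p x"
        using r by (simp add: field_simps)
    qed
  qed
qed

text \<open>
  By Zorn's lemma there is a minimal sublinear functional \<open>m\<close> below \<open>p\<close>. Shrinking \<open>m\<close> along a single
  vector \<open>x\<close> must give \<open>m\<close> back, which says \<open>m (- x) \<le> - m x\<close>; so \<open>m\<close> is odd, and an odd sublinear
  functional is linear. Compared with extending functionals from subspaces, this avoids partial
  functions.
\<close>

lemma sublinear_above_linear:
  fixes p :: "'v::real_vector \<Rightarrow> real"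
  assumes p: "sublinear p"
  obtains \<phi> where "linear \<phi>" "\<And>x. \<phi> x \<le> p x"
proof -
  define A where "A = {q. sublinear q \<and> q \<le> p}"
  define P :: "('v \<Rightarrow> real) \<Rightarrow> ('v \<Rightarrow> real) \<Rightarrow> bool" where "P f g \<longleftrightarrow> g \<le> f" for f g
  have "\<exists>m\<in>A. \<forall>a\<in>A. P m a \<longrightarrow> a = m"
  proof (rule predicate_Zorn)
    show "partial_order_on A (relation_of P A)"
      by (intro partial_order_on_relation_ofI) (auto simp: P_def)
    fix C assume C: "C \<in> Chains (relation_of P A)"
    show "\<exists>u\<in>A. \<forall>a\<in>C. P a u"
    proof (cases "C = {}")
      case True
      then show ?thesis
        using p by (auto simp: A_def)
    next
      case False
      have CA: "q \<in> A" if "q \<in> C" for q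
        using C that by (auto simp: Chains_def relation_of_def)
      then have sub: "sublinear q" and qp: "q z \<le> p z" if "q \<in> C" for q z
        using that by (auto simp: A_def le_fun_def)
      have total: "q \<le> r \<or> r \<le> q" if "q \<in> C" "r \<in> C" for q r
        using C that by (auto simp: Chains_def relation_of_def P_def)
      define u where "u z = (INF q\<in>C. q z)" for z
      have lower: "- p (- z) \<le> q z" if "q \<in> C" for q z
        using sublinear_ge [OF sub [OF that], of z] qp [OF that, of "- z"] by simp
      have bdd: "bdd_below ((\<lambda>q. q z) ` C)" for z
        using lower by (meson bdd_belowI2)
      have u_le: "u z \<le> q z" if "q \<in> C" for q z
        unfolding u_def using bdd that by (rule cINF_lower)
      have u_ge: "b \<le> u z" if "\<And>q. q \<in> C \<Longrightarrow> b \<le> q z" for b z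
        unfolding u_def using False that by (rule cINF_greatest)
      have "sublinear u"
      proof (rule sublinearI)
        fix x y
        have *: "u (x + y) \<le> q x + r y" if qr: "q \<in> C" "r \<in> C" for q r
        proof -
          consider "q \<le> r" | "r \<le> q"
            using total qr by blast
          then show ?thesis
          proof cases
            case 1
            then show ?thesis
              using u_le [OF qr(1), of "x + y"] sublinear_add [OF sub [OF qr(1)], of x y]
              by (auto simp: le_fun_def intro: order_trans add_left_mono)
          next
            case 2
            have "u (x + y) \<le> r x + r y"
              using u_le [OF qr(2), of "x + y"] sublinear_add [OF sub [OF qr(2)], of x y] by simp
            also have "\<dots> \<le> q x + r y"
              using 2 by (simp add: le_fun_def)
            finally show ?thesis .
          qed
        qed
        have "u (x + y) - q x \<le> u y" if "q \<in> C" for q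
          using * [OF that] by (intro u_ge) (simp add: algebra_simps)
        then have "u (x + y) - u y \<le> u x"
          by (intro u_ge) (simp add: algebra_simps)
        then show "u (x + y) \<le> u x + u y"
          by simp
      next
        obtain q where "q \<in> C"
          using False by blast
        then have "u 0 \<le> 0"
          using u_le [of q 0] sublinear_zero [OF sub [OF \<open>q \<in> C\<close>]] by simp
        moreover have "0 \<le> u 0"
          by (intro u_ge) (metis sublinear_zero sub order_refl)
        ultimately show "u 0 = 0"
          by simp
      next
        fix t :: real and x assume t: "t > 0"
        have "u (t *\<^sub>R x) / t \<le> u x"
        proof (rule u_ge)
          fix q assume "q \<in> C"
          then have "u (t *\<^sub>R x) \<le> t * q x"
            using u_le [of q "t *\<^sub>R x"] sublinear_scale [OF sub, of q t x] t by simp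
          then show "u (t *\<^sub>R x) / t \<le> q x"
            using t by (simp add: field_simps)
        qed
        then show "u (t *\<^sub>R x) \<le> t * u x"
          using t by (simp add: field_simps)
      qed
      moreover have "u \<le> p"
        using False u_le qp by (fastforce simp: le_fun_def intro: order_trans)
      ultimately show ?thesis
        using u_le by (auto simp: A_def P_def le_fun_def)
    qed
  qed
  then obtain m where m: "sublinear m" "m \<le> p"
    and min: "\<And>a. sublinear a \<Longrightarrow> a \<le> m \<Longrightarrow> a = m"
    unfolding A_def P_def by (smt (verit) mem_Collect_eq order_trans)
  \<comment> \<open>minimality, applied to the functional obtained by shrinking \<open>m\<close> along \<open>x\<close>\<close>
  have odd: "m (- x) = - m x" for x
  proof (rule antisym)
    obtain p' where "sublinear p'" "\<And>z. p' z \<le> m z" "\<And>v. v \<in> {x} \<Longrightarrow> p' (- v) \<le> - m x"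
      by (rule sublinear_shrink [OF m(1), of "{x}" "m x"]) auto
    moreover from this have "p' = m"
      by (intro min) (auto simp: le_fun_def)
    ultimately show "m (- x) \<le> - m x"
      by simp
    show "- m x \<le> m (- x)"
      using sublinear_ge [OF m(1), of "- x"] by simp
  qed
  have add: "m (x + y) = m x + m y" for x y
  proof (rule antisym)
    show "m (x + y) \<le> m x + m y"
      by (rule sublinear_add [OF m(1)])
    have "m (- x + - y) \<le> m (- x) + m (- y)"
      by (rule sublinear_add [OF m(1)])
    then show "m x + m y \<le> m (x + y)"
      using odd [of "x + y"] by (simp add: odd)
  qed
  have "m (t *\<^sub>R x) = t *\<^sub>R m x" for t x
  proof (cases "t \<ge> 0")
    case True
    then show ?thesis
      by (simp add: sublinear_scale [OF m(1)])
  next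
    case False
    then have "m ((- t) *\<^sub>R x) = (- t) * m x"
      by (intro sublinear_scale [OF m(1)]) simp
    then show ?thesis
      by (simp add: odd)
  qed
  with add have "linear m"
    by (intro linearI)
  then show thesis
    using that m(2) by (auto simp: le_fun_def)
qed

theorem Hahn_Banach_separation:
  fixes q :: "'v::real_vector \<Rightarrow> real"
  assumes "sublinear q" "convex V" "V \<noteq> {}" "\<And>v. v \<in> V \<Longrightarrow> c \<le> q v"
  obtains \<phi> where "linear \<phi>" "\<And>x. \<phi> x \<le> q x" "\<And>v. v \<in> V \<Longrightarrow> c \<le> \<phi> v"
proof -
  obtain p where p: "sublinear p" "\<And>z. p z \<le> q z" "\<And>v. v \<in> V \<Longrightarrow> p (- v) \<le> - c"
    using sublinear_shrink [OF assms] by blast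
  obtain \<phi> where \<phi>: "linear \<phi>" "\<And>x. \<phi> x \<le> p x"
    using sublinear_above_linear [OF p(1)] by blast
  have "c \<le> \<phi> v" if "v \<in> V" for v
    using \<phi>(2) [of "- v"] p(3) [OF that] linear_neg [OF \<phi>(1), of v] by simp
  then show thesis
    using that \<phi> p(2) order_trans by blast
qed

section \<open>Functionals over the scalar field\<close>

lemma scalar_Re_add: "scalar_Re (z + w) = scalar_Re z + scalar_Re w"
  and scalar_Re_diff: "scalar_Re (z - w) = scalar_Re z - scalar_Re w"
  and scalar_Re_minus: "scalar_Re (- z) = - scalar_Re z"
  and scalar_Re_scaleR: "scalar_Re (r *\<^sub>R z) = r * scalar_Re z"
  and scalar_Re_zero: "scalar_Re 0 = 0"
  by (simp_all add: scalar_Re_def inner_add_left inner_diff_left)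

lemma scalar_Re_of_real: "scalar_Re (of_real r :: 'k::real_or_complex) = r"
  by (simp add: scalar_Re_def of_real_def dot_square_norm)

lemma scalar_Re_le_norm: "scalar_Re z \<le> norm z"
  using norm_cauchy_schwarz [of z 1] by (simp add: scalar_Re_def)

lemma scalar_Re_ge_norm: "- norm z \<le> scalar_Re z"
  using scalar_Re_le_norm [of "- z"] by (simp add: scalar_Re_minus)

lemma scalar_phase:
  fixes z :: "'k::real_or_complex"
  obtains \<theta> where "norm \<theta> = 1" "\<theta> * z = of_real (norm z)"
proof (cases "z = 0")
  case True
  then show thesis
    using that [of 1] by simp
next
  case False
  then show thesis
    using that [of "of_real (norm z) / z"] by (simp add: norm_divide)
qed

text \<open>
  If \<open>i\<^sup>2 = - 1\<close>, then the multiplicativity of the norm forces \<open>i\<close> to be orthogonal to \<open>1\<close>: the product of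
  \<open>\<parallel>1 + i\<parallel>\<^sup>2 = 2 + 2 (i \<bullet> 1)\<close> and \<open>\<parallel>1 - i\<parallel>\<^sup>2 = 2 - 2 (i \<bullet> 1)\<close> is \<open>\<parallel>1 - i\<^sup>2\<parallel>\<^sup>2 = 4\<close>.
\<close>

lemma imaginary_unit:
  obtains i :: "'k::real_or_complex"
  where "i = 0 \<or> i * i = - 1" "\<And>z. \<exists>a b. z = a *\<^sub>R 1 + b *\<^sub>R i" "scalar_Re i = 0"
proof -
  obtain i :: 'k where i: "i = 0 \<or> i * i = - 1" "\<forall>z. \<exists>a b. z = a *\<^sub>R 1 + b *\<^sub>R i"
    using real_or_complex by blast
  have "scalar_Re i = 0"
  proof (cases "i = 0")
    case False
    with i have ii: "i * i = - 1"
      by blast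
    then have "norm i * norm i = 1"
      by (metis norm_minus_cancel norm_mult norm_one)
    then have "norm i = 1"
      using norm_ge_zero [of i] by (metis abs_of_nonneg power2_eq_square real_sqrt_abs real_sqrt_one)
    then have dots: "i \<bullet> i = 1" "(1::'k) \<bullet> 1 = 1"
      by (simp_all add: dot_square_norm)
    have "(1 + i) * (1 - i) = 2"
      using ii by (simp add: algebra_simps)
    then have "norm (1 + i) * norm (1 - i) = 2"
      by (metis norm_mult norm_numeral)
    then have "(norm (1 + i))\<^sup>2 * (norm (1 - i))\<^sup>2 = 4"
      by (simp flip: power_mult_distrib)
    moreover have "(norm (1 + i))\<^sup>2 = 2 + 2 * (i \<bullet> 1)" "(norm (1 - i))\<^sup>2 = 2 - 2 * (i \<bullet> 1)"
      by (simp_all add: power2_norm_eq_inner inner_add_left inner_add_right inner_diff_left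
        inner_diff_right dots inner_commute)
    ultimately have "(2 + 2 * (i \<bullet> 1)) * (2 - 2 * (i \<bullet> 1)) = 4"
      by simp
    then have "(i \<bullet> 1)\<^sup>2 = 0"
      by (simp add: algebra_simps power2_eq_square)
    then show ?thesis
      by (simp add: scalar_Re_def)
  qed (simp add: scalar_Re_zero)
  then show thesis
    using i that by blast
qed

lemma
  assumes "banach_space_over smul"
  shows smul_add: "smul c (x + y) = smul c x + smul c y"
    and smul_add_left: "smul (c + d) x = smul c x + smul d x"
    and smul_smul: "smul c (smul d x) = smul (c * d) x"
    and smul_of_real: "smul (of_real r) x = r *\<^sub>R x"
    and norm_smul: "norm (smul c x) = norm c * norm x"
  using assms by (auto simp: banach_space_over_def vector_space_def)

lemma dual_space_smul: "f \<in> dual_space smul \<Longrightarrow> blinfun_apply f (smul c x) = c * blinfun_apply f x"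
  by (simp add: dual_space_def)

text \<open>
  The classical formula \<open>g x = \<phi> x - \<phi> (i x) i\<close> covers real scalars as well, where \<open>i = 0\<close>.
\<close>

lemma complexify:
  fixes smul :: "'k::real_or_complex \<Rightarrow> 'a::banach \<Rightarrow> 'a"
  assumes B: "banach_space_over smul" and \<phi>: "bounded_linear \<phi>"
  obtains g where "g \<in> dual_space smul" "\<And>x. scalar_Re (blinfun_apply g x) = \<phi> x"
proof -
  obtain i :: 'k where i: "i = 0 \<or> i * i = - 1" "\<And>z. \<exists>a b. z = a *\<^sub>R 1 + b *\<^sub>R i" "scalar_Re i = 0"
    using imaginary_unit by blast
  interpret \<phi>: bounded_linear \<phi>
    by (rule \<phi>)
  have scale: "smul c (r *\<^sub>R x) = r *\<^sub>R smul c x" for c r x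
    using smul_smul [OF B] by (metis mult.commute smul_of_real [OF B])
  have "bounded_linear (smul i)"
    by (rule bounded_linear_intro [where K = "norm i"])
      (simp_all add: smul_add [OF B] scale norm_smul [OF B])
  then have "bounded_linear (\<lambda>x. \<phi> (smul i x))"
    by (rule bounded_linear_compose [OF \<phi>])
  then have bl: "bounded_linear (\<lambda>x. \<phi> x *\<^sub>R 1 - \<phi> (smul i x) *\<^sub>R i)"
    by (intro bounded_linear_sub bounded_linear_scaleR_const \<phi>)
  define g where "g = Blinfun (\<lambda>x. \<phi> x *\<^sub>R 1 - \<phi> (smul i x) *\<^sub>R i)"
  have g: "blinfun_apply g x = \<phi> x *\<^sub>R 1 - \<phi> (smul i x) *\<^sub>R i" for x
    unfolding g_def by (simp add: bounded_linear_Blinfun_apply [OF bl])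
  have "blinfun_apply g (smul c x) = c * blinfun_apply g x" for c x
  proof -
    obtain a b where c: "c = a *\<^sub>R 1 + b *\<^sub>R i"
      using i(2) by blast
    have smul_real: "smul (r *\<^sub>R d) x = r *\<^sub>R smul d x" for r d
      using smul_smul [OF B, of "of_real r" d x] by (simp add: smul_of_real [OF B] scaleR_conv_of_real)
    have one: "smul 1 x = x"
      using smul_of_real [OF B, of 1 x] by simp
    have c1: "smul c x = a *\<^sub>R x + b *\<^sub>R smul i x"
      by (simp add: c smul_add_left [OF B] smul_real one)
    show ?thesis
    proof (cases "i = 0")
      case True
      have "smul 0 x = 0"
        using smul_of_real [OF B, of 0 x] by simp
      then show ?thesis
        unfolding g c1 using True by (simp add: c \<phi>.scaleR)
    next
      case False
      then have ii: "i * i = - 1"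
        using i(1) by blast
      then have "smul i (smul i x) = - x"
        using smul_smul [OF B, of i i x] smul_of_real [OF B, of "- 1" x] by simp
      then have c2: "smul i (smul c x) = a *\<^sub>R smul i x - b *\<^sub>R x"
        by (simp add: c1 smul_add [OF B] scale)
      show ?thesis
        unfolding g c2 unfolding c1
        by (simp add: c \<phi>.add \<phi>.diff \<phi>.scaleR ring_distribs ii scaleR_add_left scaleR_diff_left
          scaleR_add_right scaleR_diff_right ac_simps)
    qed
  qed
  then have "g \<in> dual_space smul"
    by (simp add: dual_space_def)
  moreover have "scalar_Re (blinfun_apply g x) = \<phi> x" for x
    using scalar_Re_of_real [of 1, where 'k = 'k]
    by (simp add: g scalar_Re_diff scalar_Re_scaleR i(3))
  ultimately show thesis
    using that by blast
qed

lemma dual_norm_bound: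
  assumes "f \<in> dual_space smul" and R: "R > 0" and le: "\<And>x. norm x \<le> R \<Longrightarrow> norm (blinfun_apply f x) \<le> C"
  shows "R * norm f \<le> C"
proof -
  have "norm f \<le> C / R"
  proof (rule norm_blinfun_bound)
    show "0 \<le> C / R"
      using le [of 0] R by simp
    show "norm (blinfun_apply f x) \<le> C / R * norm x" for x
    proof (cases "x = 0")
      case False
      have "norm (blinfun_apply f ((R / norm x) *\<^sub>R x)) \<le> C"
        using R False by (intro le) simp
      then show ?thesis
        using R False by (simp add: blinfun.scaleR_right field_simps)
    qed (simp add: blinfun.zero_right)
  qed
  then show ?thesis
    using R by (simp add: field_simps)
qed

text \<open>
  Multiplying \<open>x\<close> by a unimodular scalar turns \<open>f x\<close> into its absolute value. In this way bounds on
  real parts, which are what separation arguments provide, become bounds on norms.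
\<close>

lemma dual_Re_attains_norm:
  assumes B: "banach_space_over smul" and f: "f \<in> dual_space smul"
  obtains x' where "norm x' = norm x" "blinfun_apply f x' = of_real (norm (blinfun_apply f x))"
proof -
  obtain \<theta> where "norm \<theta> = 1" "\<theta> * blinfun_apply f x = of_real (norm (blinfun_apply f x))"
    using scalar_phase by blast
  then show thesis
    using that [of "smul \<theta> x"] by (simp add: norm_smul [OF B] dual_space_smul [OF f])
qed

text \<open>
  The Riesz representation of real functionals on the scalar field, obtained by regarding the field as
  a Banach space over itself.
\<close>

lemma scalar_inner:
  fixes w :: "'k::real_or_complex"
  obtains c where "\<And>z. w \<bullet> z = scalar_Re (c * z)"
proof -
  have "banach_space_over ((*) :: 'k \<Rightarrow> 'k \<Rightarrow> 'k)"
    by (simp add: banach_space_over_def vector_space_def norm_mult scaleR_conv_of_real algebra_simps)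
  then obtain g where g: "g \<in> dual_space ((*) :: 'k \<Rightarrow> 'k \<Rightarrow> 'k)"
      "\<And>z. scalar_Re (blinfun_apply g z) = w \<bullet> z"
    using complexify bounded_linear_inner_right [of w] by blast
  have "blinfun_apply g z = blinfun_apply g 1 * z" for z
    using dual_space_smul [OF g(1), of z 1] by (simp add: mult.commute)
  then show thesis
    using that [of "blinfun_apply g 1"] g(2) by metis
qed


section \<open>Extreme points of the dual ball\<close>

lemma dual_space_add: "f \<in> dual_space smul \<Longrightarrow> g \<in> dual_space smul \<Longrightarrow> f + g \<in> dual_space smul"
  and dual_space_diff: "f \<in> dual_space smul \<Longrightarrow> g \<in> dual_space smul \<Longrightarrow> f - g \<in> dual_space smul"
  and dual_space_scale: "f \<in> dual_space smul \<Longrightarrow> dual_scale c f \<in> dual_space smul"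
  and dual_space_zero: "0 \<in> dual_space smul"
  by (auto simp: dual_space_def blinfun.bilinear_simps algebra_simps)

lemma dual_scale_of_real: "dual_scale (of_real r) f = r *\<^sub>R f"
  by (rule blinfun_eqI) (simp add: blinfun.bilinear_simps scaleR_conv_of_real)

lemma dual_space_scaleR: "f \<in> dual_space smul \<Longrightarrow> r *\<^sub>R f \<in> dual_space smul"
  using dual_space_scale [of f smul "of_real r"] by (simp add: dual_scale_of_real)

lemma norm_dual_scale [simp]: "norm (dual_scale c f) = norm c * norm f"
proof (rule antisym)
  have le: "norm (dual_scale c f) \<le> norm c * norm f" for c :: 'b and f :: "'a \<Rightarrow>\<^sub>L 'b"
    by (rule norm_blinfun_bound) (auto simp: norm_mult mult.assoc intro: mult_left_mono norm_blinfun)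
  show "norm (dual_scale c f) \<le> norm c * norm f"
    by (rule le)
  show "norm c * norm f \<le> norm (dual_scale c f)"
  proof (cases "c = 0")
    case False
    then have "f = dual_scale (inverse c) (dual_scale c f)"
      by (intro blinfun_eqI) (simp flip: mult.assoc)
    then have "norm f \<le> inverse (norm c) * norm (dual_scale c f)"
      using le [of "inverse c" "dual_scale c f"] by (simp add: norm_inverse)
    then show ?thesis
      using False by (simp add: field_simps)
  qed simp
qed

lemma ext_dual_ball_dual: "e \<in> ext_dual_ball smul \<Longrightarrow> e \<in> dual_space smul"
  and ext_dual_ball_norm_le: "e \<in> ext_dual_ball smul \<Longrightarrow> norm e \<le> 1"
  by (auto simp: ext_dual_ball_def dual_ball_def extreme_point_of_def)

lemma ext_dual_ball_convex_combination:
  assumes "e \<in> ext_dual_ball smul" "f \<in> dual_ball smul" "g \<in> dual_ball smul"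
    and "0 < u" "u < 1" "e = (1 - u) *\<^sub>R f + u *\<^sub>R g"
  shows "f = e"
proof -
  have "f = g"
  proof (rule ccontr)
    assume "f \<noteq> g"
    then have "e \<in> open_segment f g"
      unfolding in_segment(2) using assms(4-6) by blast
    then show False
      using assms(1-3) by (auto simp: ext_dual_ball_def extreme_point_of_def)
  qed
  then show ?thesis
    using assms(6) by (simp flip: scaleR_add_left)
qed

text \<open>
  An extreme point of norm strictly between \<open>0\<close> and \<open>1\<close> would lie between \<open>0\<close> and its normalisation.
  Only in a trivial dual space is \<open>0\<close> an extreme point of the ball, and \<open>f\<close> rules that out.
\<close>

lemma norm_ext_dual_ball:
  assumes e: "e \<in> ext_dual_ball smul" and f: "f \<in> dual_space smul" "f \<noteq> 0"
  shows "norm e = 1"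
proof (cases "e = 0")
  case True
  define g where "g = (1 / norm f) *\<^sub>R f"
  have g: "g \<in> dual_ball smul" "- g \<in> dual_ball smul"
    using f dual_space_scaleR [of f smul "1 / norm f"] dual_space_scaleR [of f smul "- (1 / norm f)"]
    by (auto simp: g_def dual_ball_def)
  have "g = e"
    by (rule ext_dual_ball_convex_combination [OF e g, of "1/2"]) (auto simp: True)
  then show ?thesis
    using f True by (simp add: g_def)
next
  case False
  show ?thesis
  proof (rule ccontr)
    assume "norm e \<noteq> 1"
    then have lt: "norm e < 1"
      using ext_dual_ball_norm_le [OF e] by simp
    have "0 = e"
    proof (rule ext_dual_ball_convex_combination [OF e])
      show "0 \<in> dual_ball smul"
        by (simp add: dual_ball_def dual_space_zero)
      show "(1 / norm e) *\<^sub>R e \<in> dual_ball smul"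
        using False dual_space_scaleR ext_dual_ball_dual [OF e] by (auto simp: dual_ball_def)
    qed (use False lt in auto)
    then show False
      using False by simp
  qed
qed

lemma linearly_independent_pair_nonzero:
  assumes "linearly_independent_pair f g"
  shows "f \<noteq> 0" "f \<noteq> g"
proof -
  have *: "dual_scale a f + dual_scale b g = 0 \<Longrightarrow> a = 0 \<and> b = 0" for a b
    using assms unfolding linearly_independent_pair_def by blast
  show "f \<noteq> 0"
  proof
    assume "f = 0"
    then have "dual_scale 1 f + dual_scale 0 g = 0"
      by (intro blinfun_eqI) (simp add: blinfun.bilinear_simps)
    then show False
      using * [of 1 0] by simp
  qed
  show "f \<noteq> g"
  proof
    assume "f = g"
    then have "dual_scale 1 f + dual_scale (- 1) g = 0"
      by (intro blinfun_eqI) (simp add: blinfun.bilinear_simps)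
    then show False
      using * [of 1 "- 1"] by simp
  qed
qed

text \<open>
  The number \<open>a\<close> is the coordinate of \<open>f\<close> along \<open>e\<close> if \<open>f - a e\<close> is a complementary part of \<open>f\<close> in the
  sense of an \<open>\<ell>\<^sub>1\<close>-sum. The map from \<open>f\<close> to \<open>a\<close> is not required to be linear, since the arguments below
  treat one functional at a time.
\<close>

definition L_coordinate ::
    "('a::banach \<Rightarrow>\<^sub>L 'k::real_or_complex) \<Rightarrow> ('a \<Rightarrow>\<^sub>L 'k) \<Rightarrow> 'k \<Rightarrow> bool"
  where "L_coordinate e f a \<longleftrightarrow>
    (\<forall>b c. norm (dual_scale b e + dual_scale c (f - dual_scale a e)) =
      norm b + norm c * norm (f - dual_scale a e))"


section \<open>Atoms of the dual space\<close>

text \<open>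
  The isometry \<open>T\<close> of the dual onto \<open>L\<^sub>1(M)\<close>, in terms of representatives.
\<close>

locale L1_representation =
  fixes smul :: "'k::real_or_complex \<Rightarrow> 'a::banach \<Rightarrow> 'a" and M :: "'m measure"
    and T :: "('a \<Rightarrow>\<^sub>L 'k) \<Rightarrow> 'm \<Rightarrow> 'k"
  assumes integrable_T: "f \<in> dual_space smul \<Longrightarrow> integrable M (T f)"
    and T_add: "f \<in> dual_space smul \<Longrightarrow> g \<in> dual_space smul \<Longrightarrow>
      AE t in M. T (f + g) t = T f t + T g t"
    and T_scale: "f \<in> dual_space smul \<Longrightarrow> AE t in M. T (dual_scale c f) t = c * T f t"
    and norm_T: "f \<in> dual_space smul \<Longrightarrow> (\<integral>t. norm (T f t) \<partial>M) = norm f"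
    and T_onto: "integrable M h \<Longrightarrow> \<exists>f\<in>dual_space smul. AE t in M. T f t = h t"
begin

lemma measurable_T: "f \<in> dual_space smul \<Longrightarrow> T f \<in> borel_measurable M"
  by (intro borel_measurable_integrable integrable_T)

lemma T_diff:
  assumes "f \<in> dual_space smul" "g \<in> dual_space smul"
  shows "AE t in M. T (f - g) t = T f t - T g t"
proof -
  have eq: "f - g = f + dual_scale (- 1) g"
    by (rule blinfun_eqI) (simp add: blinfun.bilinear_simps)
  show ?thesis
    unfolding eq
    using T_add [OF assms(1) dual_space_scale [OF assms(2), of "- 1"]] T_scale [OF assms(2), of "- 1"]
    by eventually_elim simp
qed

lemma T_inject:
  assumes "f \<in> dual_space smul" "g \<in> dual_space smul" "AE t in M. T f t = T g t"
  shows "f = g"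
proof -
  have "AE t in M. norm (T (f - g) t) = 0"
    using T_diff [OF assms(1,2)] assms(3) by (auto elim!: eventually_rev_mp)
  then have "(\<integral>t. norm (T (f - g) t) \<partial>M) = 0"
    by (rule integral_eq_zero_AE)
  then show ?thesis
    using norm_T [OF dual_space_diff [OF assms(1,2)]] by simp
qed

lemma AE_zero_if_norm_zero:
  assumes "f \<in> dual_space smul" "norm f = 0"
  shows "AE t in M. T f t = 0"
proof -
  have "AE t in M. T (dual_scale 0 f) t = 0 * T f t"
    by (rule T_scale [OF assms(1)])
  moreover have "dual_scale 0 f = f"
    using assms(2) by (intro blinfun_eqI) simp
  ultimately show ?thesis
    by simp
qed

text \<open>
  Cutting \<open>T e\<close> at a set \<open>A\<close> writes \<open>e\<close> as a sum of two functionals whose norms add up to \<open>1\<close>.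
  If neither vanished, normalising them would represent \<open>e\<close> as a proper convex combination, and
  extremality would make the part on \<open>A\<close> a positive multiple of \<open>T e\<close>, which must then vanish off \<open>A\<close>.
\<close>

lemma ext_zero_one:
  assumes e: "e \<in> ext_dual_ball smul" and ne: "norm e = 1" and A: "A \<in> sets M"
  shows "(AE t in M. t \<in> A \<longrightarrow> T e t = 0) \<or> (AE t in M. t \<notin> A \<longrightarrow> T e t = 0)"
proof -
  note d = ext_dual_ball_dual [OF e]
  have "integrable M (\<lambda>t. indicator A t *\<^sub>R T e t)"
    using integrable_T [OF d] A by (rule integrable_mult_indicator [rotated])
  then obtain f where f: "f \<in> dual_space smul" "AE t in M. T f t = indicator A t *\<^sub>R T e t"
    using T_onto by blast
  define g where "g = e - f"
  have g: "g \<in> dual_space smul"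
    using d f by (simp add: g_def dual_space_diff)
  have Tg: "AE t in M. T g t = T e t - T f t"
    unfolding g_def by (rule T_diff [OF d f(1)])
  have "norm f + norm g = (\<integral>t. norm (T f t) + norm (T g t) \<partial>M)"
    using f g by (simp add: norm_T integrable_T)
  also have "\<dots> = (\<integral>t. norm (T e t) \<partial>M)"
  proof (rule integral_cong_AE)
    show "AE t in M. norm (T f t) + norm (T g t) = norm (T e t)"
      using f(2) Tg by eventually_elim (auto simp: indicator_def)
  qed (use measurable_T d f g in auto)
  finally have sum: "norm f + norm g = 1"
    using ne norm_T [OF d] by simp
  consider "norm f = 0" | "norm g = 0" | "norm f > 0" "norm g > 0"
    by fastforce
  then show ?thesis
  proof cases
    case 1
    then have "AE t in M. T f t = 0"
      using AE_zero_if_norm_zero f by blast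
    with f(2) have "AE t in M. t \<in> A \<longrightarrow> T e t = 0"
      by eventually_elim auto
    then show ?thesis ..
  next
    case 2
    then have "AE t in M. T g t = 0"
      using AE_zero_if_norm_zero g by blast
    with f(2) Tg have "AE t in M. t \<notin> A \<longrightarrow> T e t = 0"
      by eventually_elim auto
    then show ?thesis ..
  next
    case 3
    have "(1 / norm f) *\<^sub>R f = e"
    proof (rule ext_dual_ball_convex_combination [OF e])
      show "(1 / norm f) *\<^sub>R f \<in> dual_ball smul" "(1 / norm g) *\<^sub>R g \<in> dual_ball smul"
        using f g by (auto simp: dual_ball_def dual_space_scaleR)
      show "e = (1 - norm g) *\<^sub>R (1 / norm f) *\<^sub>R f + norm g *\<^sub>R (1 / norm g) *\<^sub>R g"
      proof -
        have "1 - norm g = norm f"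
          using sum by simp
        then show ?thesis
          using 3 by (simp only: scaleR_scaleR) (simp add: g_def)
      qed
      show "0 < norm g" "norm g < 1"
        using 3 sum by linarith+
    qed
    then have "f = dual_scale (of_real (norm f)) e"
      using 3 by (simp add: dual_scale_of_real flip: \<open>(1 / norm f) *\<^sub>R f = e\<close>)
    then have "AE t in M. T f t = of_real (norm f) * T e t"
      using T_scale [OF d, of "of_real (norm f)"] by simp
    with f(2) have "AE t in M. t \<notin> A \<longrightarrow> T e t = 0"
      by eventually_elim (use 3 in auto)
    then show ?thesis ..
  qed
qed

text \<open>
  The quotient \<open>T f / T e\<close> is measurable, so by the zero-one law it belongs either almost surely or
  almost never to a given member of a countable basis of the scalar field. Outside a single null set
  all its values therefore lie in the same basic sets, so they coincide.
\<close>

lemma ext_ratio_constant: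
  assumes e: "e \<in> ext_dual_ball smul" and ne: "norm e = 1" and f: "f \<in> dual_space smul"
  obtains a where "AE t in M. T e t \<noteq> 0 \<longrightarrow> T f t = a * T e t"
proof -
  note d = ext_dual_ball_dual [OF e]
  have "\<exists>\<B>::'k set set. countable \<B> \<and> topological_basis \<B>"
    by (rule ex_countable_basis)
  then obtain \<B> :: "'k set set" where \<B>: "countable \<B>" "topological_basis \<B>"
    by (elim exE conjE)
  have m: "(\<lambda>t. T f t / T e t) \<in> borel_measurable M"
    using measurable_T [OF d] measurable_T [OF f] by (rule borel_measurable_divide [rotated])
  define full where "full U \<longleftrightarrow> (AE t in M. T e t \<noteq> 0 \<longrightarrow> T f t / T e t \<in> U)" for U
  have "AE t in M. T e t \<noteq> 0 \<longrightarrow> (T f t / T e t \<in> U \<longleftrightarrow> full U)" if "U \<in> \<B>" for U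
  proof -
    define A where "A = {t \<in> space M. T f t / T e t \<in> U}"
    have "open U"
      using topological_basis_open [OF \<B>(2) that] .
    then have "A \<in> sets M"
      unfolding A_def using measurable_sets [OF m borel_open] by (simp add: vimage_def Int_def conj_commute)
    from ext_zero_one [OF e ne this] show ?thesis
    proof
      assume 1: "AE t in M. t \<in> A \<longrightarrow> T e t = 0"
      show ?thesis
      proof (cases "full U")
        case True
        then have "AE t in M. T e t \<noteq> 0 \<longrightarrow> T f t / T e t \<in> U"
          by (simp add: full_def)
        then show ?thesis
          by eventually_elim (use True in simp)
      next
        case False
        with 1 AE_space show ?thesis
          by eventually_elim (use False in \<open>auto simp: A_def\<close>)
      qed
    next
      assume 2: "AE t in M. t \<notin> A \<longrightarrow> T e t = 0"
      with AE_space have "AE t in M. T e t \<noteq> 0 \<longrightarrow> T f t / T e t \<in> U"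
        by eventually_elim (auto simp: A_def)
      moreover from this have "full U"
        by (simp add: full_def)
      ultimately show ?thesis
        by simp
    qed
  qed
  then have *: "AE t in M. \<forall>U\<in>\<B>. T e t \<noteq> 0 \<longrightarrow> (T f t / T e t \<in> U \<longleftrightarrow> full U)"
    unfolding AE_ball_countable [OF \<B>(1)] by blast
  have "\<not> (AE t in M. T e t = 0)"
  proof
    assume "AE t in M. T e t = 0"
    then have "AE t in M. norm (T e t) = 0"
      by simp
    then have "(\<integral>t. norm (T e t) \<partial>M) = 0"
      by (rule integral_eq_zero_AE)
    then show False
      using norm_T [OF d] ne by simp
  qed
  moreover have "AE t in M. T e t = 0"
    if "\<And>t. \<forall>U\<in>\<B>. T e t \<noteq> 0 \<longrightarrow> (T f t / T e t \<in> U \<longleftrightarrow> full U) \<Longrightarrow> T e t = 0"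
    using * by (rule eventually_mono) (rule that)
  ultimately obtain s where s: "T e s \<noteq> 0" "\<forall>U\<in>\<B>. T f s / T e s \<in> U \<longleftrightarrow> full U"
    by blast
  have "AE t in M. T e t \<noteq> 0 \<longrightarrow> T f t = (T f s / T e s) * T e t"
    using *
  proof eventually_elim
    case (elim t)
    show ?case
    proof
      assume t: "T e t \<noteq> 0"
      have "T f t / T e t = T f s / T e s"
      proof (rule ccontr)
        assume "T f t / T e t \<noteq> T f s / T e s"
        then obtain V where V: "open V" "T f t / T e t \<in> V" "T f s / T e s \<notin> V"
          using t1_space [of "T f t / T e t" "T f s / T e s"] by blast
        obtain U where U: "U \<in> \<B>" "T f t / T e t \<in> U" "U \<subseteq> V"
          by (rule topological_basisE [OF \<B>(2) V(1,2)])
        have "full U"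
          using bspec [OF elim U(1)] t U(2) by simp
        then have "T f s / T e s \<in> U"
          using bspec [OF s(2) U(1)] by simp
        with U(3) have "T f s / T e s \<in> V" ..
        with V(3) show False ..
      qed
      moreover have "T f t = (T f t / T e t) * T e t"
        using t by simp
      ultimately show "T f t = (T f s / T e s) * T e t"
        by simp
    qed
  qed
  then show thesis
    by (rule that)
qed

lemma L_coordinateI:
  assumes e: "e \<in> dual_space smul" "norm e = 1" and f: "f \<in> dual_space smul"
    and a: "AE t in M. T e t \<noteq> 0 \<longrightarrow> T f t = a * T e t"
  shows "L_coordinate e f a"
  unfolding L_coordinate_def
proof (intro allI)
  fix b c
  define h where "h = f - dual_scale a e"
  have h: "h \<in> dual_space smul"
    using e f by (simp add: h_def dual_space_diff dual_space_scale)
  have "AE t in M. T h t = T f t - T (dual_scale a e) t"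
    unfolding h_def by (rule T_diff [OF f dual_space_scale [OF e(1)]])
  with a T_scale [OF e(1), of a] have Th: "AE t in M. T e t \<noteq> 0 \<longrightarrow> T h t = 0"
    by eventually_elim auto
  have be: "dual_scale b e \<in> dual_space smul" and ch: "dual_scale c h \<in> dual_space smul"
    using e h by (auto simp: dual_space_scale)
  have "norm (dual_scale b e + dual_scale c h) = (\<integral>t. norm (T (dual_scale b e + dual_scale c h) t) \<partial>M)"
    by (rule norm_T [symmetric]) (rule dual_space_add [OF be ch])
  also have "\<dots> = (\<integral>t. norm b * norm (T e t) + norm c * norm (T h t) \<partial>M)"
  proof (rule integral_cong_AE)
    show "AE t in M. norm (T (dual_scale b e + dual_scale c h) t) =
        norm b * norm (T e t) + norm c * norm (T h t)"
      using T_add [OF be ch] T_scale [OF e(1), of b] T_scale [OF h, of c] Th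
      by eventually_elim (auto simp: norm_mult)
  qed (use measurable_T e h dual_space_add [OF be ch] in auto)
  also have "\<dots> = norm b * norm e + norm c * norm h"
    using e h by (simp add: norm_T integrable_T)
  finally show "norm (dual_scale b e + dual_scale c (f - dual_scale a e)) =
      norm b + norm c * norm (f - dual_scale a e)"
    using e by (simp add: h_def)
qed

lemma L_coordinate_exists:
  assumes "e \<in> ext_dual_ball smul" "norm e = 1" "f \<in> dual_space smul"
  obtains a where "L_coordinate e f a"
proof -
  obtain a where "AE t in M. T e t \<noteq> 0 \<longrightarrow> T f t = a * T e t"
    by (rule ext_ratio_constant [OF assms])
  then show thesis
    by (rule that [OF L_coordinateI [OF ext_dual_ball_dual [OF assms(1)] assms(2,3)]])
qed

text \<open>
  If \<open>T h\<close> did not vanish on the support of \<open>T g\<close>, the zero-one law would make it vanish outside that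
  support, and on the support it is a constant multiple of \<open>T g\<close>.
\<close>

lemma ext_disjoint:
  assumes g: "g \<in> ext_dual_ball smul" "norm g = 1" and h: "h \<in> ext_dual_ball smul" "norm h = 1"
    and indep: "linearly_independent_pair g h"
  shows "AE t in M. T g t = 0 \<or> T h t = 0"
proof -
  note dg = ext_dual_ball_dual [OF g(1)] and dh = ext_dual_ball_dual [OF h(1)]
  define A where "A = {t \<in> space M. T g t \<noteq> 0}"
  have "A \<in> sets M"
    unfolding A_def using measurable_T [OF dg] by measurable
  from ext_zero_one [OF h this] show ?thesis
  proof
    assume "AE t in M. t \<in> A \<longrightarrow> T h t = 0"
    with AE_space show ?thesis
      by eventually_elim (auto simp: A_def)
  next
    assume 2: "AE t in M. t \<notin> A \<longrightarrow> T h t = 0"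
    obtain b where b: "AE t in M. T g t \<noteq> 0 \<longrightarrow> T h t = b * T g t"
      using ext_ratio_constant [OF g dh] by blast
    have "h = dual_scale b g"
    proof (rule T_inject [OF dh dual_space_scale [OF dg]])
      show "AE t in M. T h t = T (dual_scale b g) t"
        using 2 b T_scale [OF dg, of b] by eventually_elim (auto simp: A_def)
    qed
    then have "dual_scale b g + dual_scale (- 1) h = 0"
      by (auto intro!: blinfun_eqI simp: blinfun.bilinear_simps)
    then show ?thesis
      using indep unfolding linearly_independent_pair_def by force
  qed
qed

text \<open>
  The sum of the absolute values of the coordinates of \<open>f\<close> along finitely many members of \<open>J\<close> is at
  most \<open>\<parallel>f\<parallel>\<close>, because these members have disjoint supports. So only finitely many coordinates reach \<open>\<delta>\<close>.
\<close>

lemma small_L_coordinate: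
  assumes J: "J \<subseteq> ext_dual_ball smul" "infinite J"
    and indep: "\<And>g h. g \<in> J \<Longrightarrow> h \<in> J \<Longrightarrow> g \<noteq> h \<Longrightarrow> linearly_independent_pair g h"
    and f: "f \<in> dual_space smul" and \<delta>: "\<delta> > 0"
  obtains g a where "g \<in> J" "norm g = 1" "L_coordinate g f a" "norm a < \<delta>"
proof -
  have norm1: "norm g = 1" if g: "g \<in> J" for g
  proof -
    have "J - {g} \<noteq> {}"
      using J(2) by (metis finite.emptyI infinite_remove)
    then obtain h where "h \<in> J" "g \<noteq> h"
      by blast
    then have "g \<noteq> 0"
      using indep [OF g] linearly_independent_pair_nonzero by blast
    then show ?thesis
      using J(1) g norm_ext_dual_ball ext_dual_ball_dual by blast
  qed
  have "\<exists>a. AE t in M. T g t \<noteq> 0 \<longrightarrow> T f t = a * T g t" if "g \<in> J" for g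
    using ext_ratio_constant [of g f] J(1) norm1 that f by blast
  then obtain a where a: "\<And>g. g \<in> J \<Longrightarrow> AE t in M. T g t \<noteq> 0 \<longrightarrow> T f t = a g * T g t"
    by metis
  have "\<exists>g\<in>J. norm (a g) < \<delta>"
  proof (rule ccontr)
    assume "\<not> (\<exists>g\<in>J. norm (a g) < \<delta>)"
    then have ge: "\<delta> \<le> norm (a g)" if "g \<in> J" for g
      using that by force
    obtain n :: nat where n: "norm f < n * \<delta>"
      using \<delta> reals_Archimedean3 by blast
    obtain F where F: "F \<subseteq> J" "finite F" "card F = n"
      using J(2) infinite_arbitrarily_large by blast
    have dual: "g \<in> dual_space smul" if "g \<in> F" for g
      using F J ext_dual_ball_dual that by blast
    have 1: "AE t in M. \<forall>g\<in>F. T g t \<noteq> 0 \<longrightarrow> T f t = a g * T g t"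
      using F a by (intro AE_finite_allI) auto
    \<comment> \<open>at almost every point at most one summand of the sum below is nonzero\<close>
    have 2: "AE t in M. \<forall>g\<in>F. \<forall>h\<in>F. g \<noteq> h \<longrightarrow> T g t = 0 \<or> T h t = 0"
      using F J by (intro AE_finite_allI) (auto intro!: ext_disjoint norm1 indep simp: subset_eq)
    have "n * \<delta> = (\<Sum>g\<in>F. \<delta> * norm g)"
      using F norm1 by (simp add: subset_eq)
    also have "\<dots> = (\<Sum>g\<in>F. \<integral>t. \<delta> * norm (T g t) \<partial>M)"
      using dual by (simp add: norm_T)
    also have "\<dots> = (\<integral>t. (\<Sum>g\<in>F. \<delta> * norm (T g t)) \<partial>M)"
      using dual integrable_T by (intro Bochner_Integration.integral_sum [symmetric]) auto
    also have "\<dots> \<le> (\<integral>t. norm (T f t) \<partial>M)"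
    proof (rule integral_mono_AE)
      show "AE t in M. (\<Sum>g\<in>F. \<delta> * norm (T g t)) \<le> norm (T f t)"
        using 1 2
      proof eventually_elim
        case (elim t)
        show ?case
        proof (cases "\<exists>g\<in>F. T g t \<noteq> 0")
          case True
          then obtain g where g: "g \<in> F" "T g t \<noteq> 0"
            by blast
          have "(\<Sum>h\<in>F. \<delta> * norm (T h t)) = (\<Sum>h\<in>{g}. \<delta> * norm (T h t))"
            using F g elim by (intro sum.mono_neutral_right) auto
          also have "\<dots> \<le> norm (a g) * norm (T g t)"
            using ge F g by (auto intro: mult_right_mono)
          also have "\<dots> = norm (T f t)"
            using elim g by (simp add: norm_mult)
          finally show ?thesis .
        qed simp
      qed
    qed (use dual f integrable_T in \<open>auto intro!: Bochner_Integration.integrable_sum\<close>)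
    also have "\<dots> = norm f"
      by (rule norm_T [OF f])
    finally show False
      using n by simp
  qed
  then obtain g where g: "g \<in> J" "norm (a g) < \<delta>"
    by blast
  moreover have "L_coordinate g f (a g)"
    using g J(1) by (intro L_coordinateI ext_dual_ball_dual norm1 f a) auto
  ultimately show thesis
    using that norm1 by blast
qed

end

section \<open>Prescribing the value of an L-summand functional\<close>

definition L_summand :: "('k::real_or_complex \<Rightarrow> 'a::banach \<Rightarrow> 'a) \<Rightarrow> ('a \<Rightarrow>\<^sub>L 'k) \<Rightarrow> bool"
  where "L_summand smul e \<longleftrightarrow> e \<in> dual_space smul \<and> norm e = 1 \<and>
    (\<forall>f\<in>dual_space smul. \<exists>a. L_coordinate e f a)"

lemma norm_apply_le: "norm f \<le> 1 \<Longrightarrow> norm (blinfun_apply f x) \<le> norm x"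
  using norm_blinfun [of f x] mult_right_mono [of "norm f" 1 "norm x"] by simp

text \<open>
  In terms of \<open>X\<^sup>*\<^sup>*\<close> the point to look for is \<open>y\<close> with its value at \<open>e\<close> replaced by \<open>s\<close>. As the bidual is
  the \<open>\<ell>\<^sub>\<infinity>\<close>-sum of the direction of \<open>e\<close> and a complement, the hypotheses say that this element is in
  the bidual balls around \<open>x1\<close> and \<open>x2\<close>; the lemma brings it down to \<open>X\<close>.

  The set \<open>V\<close> of all \<open>(x - x1, x - x2)\<close> with \<open>e x = s\<close> would otherwise miss a product of two balls of
  radii \<open>R1\<close> and \<open>R2\<close>. A functional that separates them consists of two members \<open>g1\<close> and \<open>g2\<close> of the
  dual, and their sum is a multiple of \<open>e\<close> since it is bounded below on a translate of the kernel of
  \<open>e\<close>. So \<open>g1 = a1 e + h\<close> and \<open>g2 = a2 e - h\<close> with the same \<open>h\<close>, and evaluating both at the point of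
  the bidual described above contradicts the separation.
\<close>

lemma L_summand_replace_coordinate:
  fixes smul :: "'k::real_or_complex \<Rightarrow> 'a::banach \<Rightarrow> 'a"
  assumes B: "banach_space_over smul" and L: "L_summand smul e"
    and s: "norm (s - blinfun_apply e x1) \<le> r1" "norm (s - blinfun_apply e x2) \<le> r2"
    and y: "norm (y - x1) \<le> r1" "norm (y - x2) \<le> r2"
    and \<eta>: "\<eta> > 0"
  obtains x where "blinfun_apply e x = s" "norm (x - x1) < r1 + \<eta>" "norm (x - x2) < r2 + \<eta>"
proof (rule ccontr)
  assume "\<not> thesis"
  then have contra: False if "blinfun_apply e x = s" "norm (x - x1) < r1 + \<eta>" "norm (x - x2) < r2 + \<eta>" for x
    using \<open>\<And>x. blinfun_apply e x = s \<Longrightarrow> norm (x - x1) < r1 + \<eta> \<Longrightarrow> norm (x - x2) < r2 + \<eta> \<Longrightarrow> thesis\<close> that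
    by blast
  have e: "e \<in> dual_space smul" "norm e = 1"
    using L by (auto simp: L_summand_def)
  define R1 where "R1 = r1 + \<eta>"
  define R2 where "R2 = r2 + \<eta>"
  have r: "r1 \<ge> 0" "r2 \<ge> 0"
    using y norm_ge_zero order_trans by blast+
  then have R: "R1 > 0" "R2 > 0"
    using \<eta> by (auto simp: R1_def R2_def)
  have "e \<noteq> 0"
    using e by auto
  then obtain w where w: "blinfun_apply e w \<noteq> 0"
    by (metis blinfun_eqI zero_blinfun.rep_eq)
  define x0 where "x0 = smul (s / blinfun_apply e w) w"
  have x0: "blinfun_apply e x0 = s"
    using w by (simp add: x0_def dual_space_smul [OF e(1)])
  define V where "V = {(x - x1, x - x2) | x. blinfun_apply e x = s}"
  \<comment> \<open>the gauge of the product of the two balls\<close>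
  define q :: "'a \<times> 'a \<Rightarrow> real" where "q = (\<lambda>(u, v). max (norm u / R1) (norm v / R2))"
  have "sublinear q"
  proof (rule sublinearI)
    fix p p' :: "'a \<times> 'a"
    obtain u v u' v' where p: "p = (u, v)" "p' = (u', v')"
      by (metis surj_pair)
    have "norm (u + u') / R1 \<le> norm u / R1 + norm u' / R1"
      using R norm_triangle_ineq [of u u'] by (simp add: divide_right_mono flip: add_divide_distrib)
    moreover have "norm (v + v') / R2 \<le> norm v / R2 + norm v' / R2"
      using R norm_triangle_ineq [of v v'] by (simp add: divide_right_mono flip: add_divide_distrib)
    ultimately show "q (p + p') \<le> q p + q p'"
      by (auto simp: q_def p max_def)
  next
    show "q 0 = 0"
      by (simp add: q_def zero_prod_def)
  next
    fix t :: real and p :: "'a \<times> 'a"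
    assume "t > 0"
    then show "q (t *\<^sub>R p) \<le> t * q p"
      by (cases p) (simp add: q_def max_mult_distrib_left)
  qed
  moreover have "convex V"
  proof (rule convexI)
    fix p p' :: "'a \<times> 'a" and u v :: real
    assume pp: "p \<in> V" "p' \<in> V" and uv: "0 \<le> u" "0 \<le> v" "u + v = 1"
    obtain x x' where x: "p = (x - x1, x - x2)" "blinfun_apply e x = s"
        "p' = (x' - x1, x' - x2)" "blinfun_apply e x' = s"
      using pp by (auto simp: V_def)
    have comb: "u *\<^sub>R (x - a) + v *\<^sub>R (x' - a) = (u *\<^sub>R x + v *\<^sub>R x') - a" for a
    proof -
      have "u *\<^sub>R (x - a) + v *\<^sub>R (x' - a) = (u *\<^sub>R x + v *\<^sub>R x') - (u + v) *\<^sub>R a"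
        by (simp add: algebra_simps)
      then show ?thesis
        by (simp add: uv)
    qed
    have "blinfun_apply e (u *\<^sub>R x + v *\<^sub>R x') = s"
      using uv by (simp add: blinfun.bilinear_simps x flip: scaleR_add_left)
    then show "u *\<^sub>R p + v *\<^sub>R p' \<in> V"
      unfolding V_def x by (auto simp: comb)
  qed
  moreover have "V \<noteq> {}"
    using x0 by (auto simp: V_def)
  moreover have "1 \<le> q p" if "p \<in> V" for p
  proof -
    obtain x where x: "p = (x - x1, x - x2)" "blinfun_apply e x = s"
      using \<open>p \<in> V\<close> by (auto simp: V_def)
    then have "norm (x - x1) \<ge> R1 \<or> norm (x - x2) \<ge> R2"
      using contra [OF x(2)] unfolding R1_def R2_def by (meson not_le)
    then show ?thesis
      unfolding x(1) using R by (simp add: q_def le_max_iff_disj)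
  qed
  ultimately obtain \<phi> where \<phi>: "linear \<phi>" "\<And>p. \<phi> p \<le> q p" "\<And>p. p \<in> V \<Longrightarrow> 1 \<le> \<phi> p"
    using Hahn_Banach_separation [of q V 1] by blast
  interpret \<phi>: linear \<phi>
    by (rule \<phi>(1))
  have split: "\<phi> (u, v) = \<phi> (u, 0) + \<phi> (0, v)" for u v
    using \<phi>.add [of "(u, 0)" "(0, v)"] by simp
  have "bounded_linear (\<lambda>u. \<phi> (u, 0))"
  proof (rule bounded_linear_intro [where K = "1 / R1"])
    show "\<phi> (u + u', 0) = \<phi> (u, 0) + \<phi> (u', 0)" for u u'
      using \<phi>.add [of "(u, 0)" "(u', 0)"] by simp
    show "\<phi> (t *\<^sub>R u, 0) = t *\<^sub>R \<phi> (u, 0)" for t u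
      using \<phi>.scale [of t "(u, 0)"] by simp
    show "norm (\<phi> (u, 0)) \<le> norm u * (1 / R1)" for u
      using \<phi>(2) [of "(u, 0)"] \<phi>(2) [of "(- u, 0)"] \<phi>.neg [of "(u, 0)"] R
      by (simp add: q_def abs_le_iff)
  qed
  then obtain g1 where g1: "g1 \<in> dual_space smul" "\<And>u. scalar_Re (blinfun_apply g1 u) = \<phi> (u, 0)"
    using complexify [OF B] by blast
  have "bounded_linear (\<lambda>v. \<phi> (0, v))"
  proof (rule bounded_linear_intro [where K = "1 / R2"])
    show "\<phi> (0, u + u') = \<phi> (0, u) + \<phi> (0, u')" for u u'
      using \<phi>.add [of "(0, u)" "(0, u')"] by simp
    show "\<phi> (0, t *\<^sub>R u) = t *\<^sub>R \<phi> (0, u)" for t u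
      using \<phi>.scale [of t "(0, u)"] by simp
    show "norm (\<phi> (0, u)) \<le> norm u * (1 / R2)" for u
      using \<phi>(2) [of "(0, u)"] \<phi>(2) [of "(0, - u)"] \<phi>.neg [of "(0, u)"] R
      by (simp add: q_def abs_le_iff)
  qed
  then obtain g2 where g2: "g2 \<in> dual_space smul" "\<And>u. scalar_Re (blinfun_apply g2 u) = \<phi> (0, u)"
    using complexify [OF B] by blast
  have ge1: "1 \<le> scalar_Re (blinfun_apply g1 (x - x1)) + scalar_Re (blinfun_apply g2 (x - x2))"
    if "blinfun_apply e x = s" for x
    using \<phi>(3) [of "(x - x1, x - x2)"] that split [of "x - x1" "x - x2"]
    by (auto simp: V_def g1(2) g2(2))
  have le1: "norm (blinfun_apply g1 u) + norm (blinfun_apply g2 v) \<le> 1"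
    if "norm u \<le> R1" "norm v \<le> R2" for u v
  proof -
    obtain u' where u': "norm u' = norm u" "blinfun_apply g1 u' = of_real (norm (blinfun_apply g1 u))"
      using dual_Re_attains_norm [OF B g1(1)] by blast
    obtain v' where v': "norm v' = norm v" "blinfun_apply g2 v' = of_real (norm (blinfun_apply g2 v))"
      using dual_Re_attains_norm [OF B g2(1)] by blast
    have "norm (blinfun_apply g1 u) + norm (blinfun_apply g2 v) = \<phi> (u', v')"
      using g1(2) [of u'] g2(2) [of v'] by (simp add: u' v' scalar_Re_of_real split [of u' v'])
    also have "\<dots> \<le> q (u', v')"
      by (rule \<phi>(2))
    also have "\<dots> \<le> 1"
      using that R by (simp add: q_def u' v')
    finally show ?thesis .
  qed
  have norms: "R1 * norm g1 + R2 * norm g2 \<le> 1"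
  proof -
    have "R1 * norm g1 \<le> 1 - norm (blinfun_apply g2 v)" if "norm v \<le> R2" for v
      using le1 that R by (intro dual_norm_bound [OF g1(1)]) (auto simp: algebra_simps)
    then have "R2 * norm g2 \<le> 1 - R1 * norm g1"
      using R by (intro dual_norm_bound [OF g2(1)]) (auto simp: algebra_simps)
    then show ?thesis
      by simp
  qed
  define g where "g = g1 + g2"
  have g: "g \<in> dual_space smul"
    using g1 g2 by (simp add: g_def dual_space_add)
  \<comment> \<open>a real affine function that is bounded below on the line through \<open>x0\<close> along a kernel vector is constant there\<close>
  have ker: "blinfun_apply g z = 0" if "blinfun_apply e z = 0" for z
  proof -
    obtain z' \<theta> where z': "blinfun_apply g z' = of_real (norm (blinfun_apply g z))" "z' = smul \<theta> z"
    proof -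
      obtain \<theta> where "\<theta> * blinfun_apply g z = of_real (norm (blinfun_apply g z))"
        using scalar_phase by blast
      then show thesis
        using that by (simp add: dual_space_smul [OF g])
    qed
    define N where "N = norm (blinfun_apply g z)"
    define K where "K = scalar_Re (blinfun_apply g1 (x0 - x1)) + scalar_Re (blinfun_apply g2 (x0 - x2))"
    have "scalar_Re (blinfun_apply g1 z') + scalar_Re (blinfun_apply g2 z') = N"
      using arg_cong [OF z'(1), of scalar_Re]
      by (simp add: g_def blinfun.add_left scalar_Re_add scalar_Re_of_real N_def)
    then have *: "1 \<le> K + t * N" for t
      using ge1 [of "x0 + t *\<^sub>R z'"] that
      by (simp add: x0 z'(2) dual_space_smul [OF e(1)] blinfun.bilinear_simps K_def
        scalar_Re_add scalar_Re_diff scalar_Re_scaleR algebra_simps flip: distrib_left)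
    show ?thesis
    proof (rule ccontr)
      assume "blinfun_apply g z \<noteq> 0"
      then have "N \<noteq> 0"
        by (simp add: N_def)
      then show False
        using * [of "- K / N"] by simp
    qed
  qed
  define c where "c = blinfun_apply g w / blinfun_apply e w"
  have gc: "blinfun_apply g z = c * blinfun_apply e z" for z
  proof -
    have "blinfun_apply g (z - smul (blinfun_apply e z / blinfun_apply e w) w) = 0"
      using w by (intro ker) (simp add: blinfun.bilinear_simps dual_space_smul [OF e(1)])
    then show ?thesis
      by (simp add: blinfun.bilinear_simps dual_space_smul [OF g] c_def)
  qed
  obtain a1 where a1: "L_coordinate e g1 a1"
    using L g1(1) by (auto simp: L_summand_def)
  define h where "h = g1 - dual_scale a1 e"
  define a2 where "a2 = c - a1"
  have h: "h \<in> dual_space smul"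
    using g1 e by (simp add: h_def dual_space_diff dual_space_scale)
  have g1h: "g1 = dual_scale a1 e + dual_scale 1 h"
    by (rule blinfun_eqI) (simp add: h_def blinfun.bilinear_simps)
  have g2h: "g2 = dual_scale a2 e + dual_scale (- 1) h"
  proof (rule blinfun_eqI)
    fix z
    have "blinfun_apply g1 z + blinfun_apply g2 z = c * blinfun_apply e z"
      using gc [of z] by (simp add: g_def blinfun.bilinear_simps)
    then show "blinfun_apply g2 z = blinfun_apply (dual_scale a2 e + dual_scale (- 1) h) z"
      by (simp add: h_def a2_def blinfun.bilinear_simps algebra_simps)
  qed
  have n1: "norm g1 = norm a1 + norm h"
    using a1 unfolding L_coordinate_def h_def [symmetric] by (subst g1h) simp
  have n2: "norm g2 = norm a2 + norm h"
    using a1 unfolding L_coordinate_def h_def [symmetric] by (subst g2h) simp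
  have "blinfun_apply g1 (x0 - x1) + blinfun_apply g2 (x0 - x2) =
      (a1 * (s - blinfun_apply e x1) + blinfun_apply h (y - x1)) +
      (a2 * (s - blinfun_apply e x2) - blinfun_apply h (y - x2))"
    by (subst g1h, subst g2h) (simp add: blinfun.bilinear_simps x0 algebra_simps)
  then have "1 \<le> scalar_Re ((a1 * (s - blinfun_apply e x1) + blinfun_apply h (y - x1)) +
      (a2 * (s - blinfun_apply e x2) - blinfun_apply h (y - x2)))"
    using ge1 [OF x0] by (simp flip: scalar_Re_add)
  also have "\<dots> \<le> norm ((a1 * (s - blinfun_apply e x1) + blinfun_apply h (y - x1)) +
      (a2 * (s - blinfun_apply e x2) - blinfun_apply h (y - x2)))"
    by (rule scalar_Re_le_norm)
  also have "\<dots> \<le> (norm a1 * r1 + norm h * r1) + (norm a2 * r2 + norm h * r2)"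
  proof (intro norm_triangle_le norm_triangle_le_diff add_mono)
    show "norm (a1 * (s - blinfun_apply e x1)) \<le> norm a1 * r1"
      "norm (a2 * (s - blinfun_apply e x2)) \<le> norm a2 * r2"
      using s by (simp_all add: norm_mult mult_left_mono)
    show "norm (blinfun_apply h (y - x1)) \<le> norm h * r1" "norm (blinfun_apply h (y - x2)) \<le> norm h * r2"
      using y by (meson norm_blinfun mult_left_mono norm_ge_zero order_trans)+
  qed
  also have "\<dots> = r1 * norm g1 + r2 * norm g2"
    by (simp add: n1 n2 algebra_simps)
  finally have ge: "1 \<le> r1 * norm g1 + r2 * norm g2" .
  with norms have "\<eta> * (norm g1 + norm g2) \<le> 0"
    by (simp add: R1_def R2_def algebra_simps)
  then have "norm g1 + norm g2 \<le> 0"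
    using \<eta> by (simp add: mult_le_0_iff)
  then have "norm g1 = 0" "norm g2 = 0"
    using norm_ge_zero [of g1] norm_ge_zero [of g2] by linarith+
  with ge show False
    by simp
qed

text \<open>
  The kernel of \<open>e\<close> is an M-ideal, and this is its proximinality. Scaling a point of norm at most
  \<open>1 + \<delta>\<close> into the ball moves it by at most \<open>\<delta>\<close>; restoring the value at \<open>e\<close> afterwards costs an error
  in the norm of \<open>\<delta> / 2\<close>. Iteration gives a Cauchy sequence whose limit lies in the ball.
\<close>

lemma L_summand_norm_one_correction:
  fixes smul :: "'k::real_or_complex \<Rightarrow> 'a::banach \<Rightarrow> 'a"
  assumes B: "banach_space_over smul" and L: "L_summand smul e"
    and s: "norm s = 1" "blinfun_apply e u = s" and u: "norm u \<le> 1 + \<eta>" and \<eta>: "\<eta> > 0"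
  obtains x where "blinfun_apply e x = s" "norm x \<le> 1" "norm (x - u) \<le> 4 * \<eta>"
proof -
  \<comment> \<open>the error in the norm that is left after \<open>n\<close> steps\<close>
  define \<delta> where "\<delta> n = \<eta> * (1 / 2) ^ n" for n :: nat
  have \<delta>: "\<delta> n > 0" for n
    using \<eta> by (simp add: \<delta>_def)
  have step: "\<exists>x'. (blinfun_apply e x' = s \<and> norm x' \<le> 1 + \<delta> (Suc n) \<and> (Suc n = 0 \<longrightarrow> x' = u)) \<and>
      norm (x' - x) \<le> 2 * \<delta> n"
    if x: "blinfun_apply e x = s \<and> norm x \<le> 1 + \<delta> n \<and> (n = 0 \<longrightarrow> x = u)" for x n
  proof -
    define y where "y = (1 / (1 + \<delta> n)) *\<^sub>R x"
    have pos: "1 + \<delta> n > 0"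
      using \<delta> [of n] by simp
    \<comment> \<open>both the unit ball and the ball of radius \<open>\<delta> n\<close> around \<open>x\<close> contain \<open>y\<close>\<close>
    have "y - x = - ((\<delta> n / (1 + \<delta> n)) *\<^sub>R x)"
    proof -
      have "1 / (1 + \<delta> n) - 1 = - (\<delta> n / (1 + \<delta> n))"
        using pos by (simp add: field_simps)
      then show ?thesis
        by (metis y_def scaleR_one scaleR_left.diff scaleR_minus_left)
    qed
    then have "norm (y - x) = \<delta> n / (1 + \<delta> n) * norm x"
      using \<delta> [of n] by simp
    also have "\<dots> \<le> \<delta> n / (1 + \<delta> n) * (1 + \<delta> n)"
      using x \<delta> [of n] by (intro mult_left_mono) auto
    finally have "norm (y - x) \<le> \<delta> n"
      using pos by simp
    moreover have "norm (y - 0) \<le> 1"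
      using x pos by (simp add: y_def)
    ultimately obtain x' where "blinfun_apply e x' = s" "norm (x' - 0) < 1 + \<delta> (Suc n)"
        "norm (x' - x) < \<delta> n + \<delta> (Suc n)"
      using L_summand_replace_coordinate [OF B L, of s 0 1 x "\<delta> n" y "\<delta> (Suc n)"] x s \<delta> [of n] \<delta> [of "Suc n"]
      by (auto simp: blinfun.zero_right)
    moreover have "\<delta> (Suc n) \<le> \<delta> n"
      using \<eta> by (simp add: \<delta>_def)
    ultimately show ?thesis
      by (intro exI [of _ x']) auto
  qed
  have "\<exists>f. \<forall>n. (blinfun_apply e (f n) = s \<and> norm (f n) \<le> 1 + \<delta> n \<and> (n = 0 \<longrightarrow> f n = u)) \<and>
      norm (f (Suc n) - f n) \<le> 2 * \<delta> n"
    by (rule dependent_nat_choice) (use s u step in \<open>auto simp: \<delta>_def\<close>)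
  then obtain f where f: "\<And>n. blinfun_apply e (f n) = s" "\<And>n. norm (f n) \<le> 1 + \<delta> n" "f 0 = u"
      "\<And>n. norm (f (Suc n) - f n) \<le> 2 * \<delta> n"
    by blast
  have sums: "(\<lambda>n. 2 * \<delta> n) sums (4 * \<eta>)"
    using sums_mult [OF geometric_sums [of "1 / 2 :: real"], of "2 * \<eta>"] by (simp add: \<delta>_def ac_simps)
  have nsum: "summable (\<lambda>n. norm (f (Suc n) - f n))"
    using f(4) by (intro summable_comparison_test' [OF sums_summable [OF sums], of 0]) simp
  define d where "d = (\<Sum>n. f (Suc n) - f n)"
  have "(\<lambda>n. \<Sum>i<n. f (Suc i) - f i) \<longlonglongrightarrow> d"
    unfolding d_def by (rule summable_LIMSEQ [OF summable_norm_cancel [OF nsum]])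
  then have "(\<lambda>n. f n - u) \<longlonglongrightarrow> d"
    by (simp add: sum_lessThan_telescope f(3))
  then have lim: "f \<longlonglongrightarrow> d + u"
    using tendsto_add [OF _ tendsto_const [of u]] by fastforce
  have "norm d \<le> (\<Sum>n. norm (f (Suc n) - f n))"
    unfolding d_def by (rule summable_norm [OF nsum])
  also have "\<dots> \<le> (\<Sum>n. 2 * \<delta> n)"
    using f(4) nsum sums_summable [OF sums] by (intro suminf_le) auto
  also have "\<dots> = 4 * \<eta>"
    using sums by (rule sums_unique [symmetric])
  finally have "norm ((d + u) - u) \<le> 4 * \<eta>"
    by simp
  moreover have "blinfun_apply e (d + u) = s"
  proof (rule LIMSEQ_unique)
    show "(\<lambda>n. blinfun_apply e (f n)) \<longlonglongrightarrow> blinfun_apply e (d + u)"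
      by (intro tendsto_intros lim)
    show "(\<lambda>n. blinfun_apply e (f n)) \<longlonglongrightarrow> s"
      by (simp add: f(1))
  qed
  moreover have "norm (d + u) \<le> 1"
  proof (rule LIMSEQ_le)
    show "(\<lambda>n. norm (f n)) \<longlonglongrightarrow> norm (d + u)"
      by (intro tendsto_norm lim)
    have "\<delta> \<longlonglongrightarrow> 0"
      using tendsto_mult_left [OF LIMSEQ_power_zero [of "1 / 2 :: real"], of \<eta>] by (simp add: \<delta>_def [abs_def])
    then show "(\<lambda>n. 1 + \<delta> n) \<longlonglongrightarrow> 1"
      using tendsto_add [OF tendsto_const [of 1]] by force
  qed (use f(2) in auto)
  ultimately show thesis
    using that by blast
qed

text \<open>
  Write \<open>e z = \<bar>e z\<bar> \<theta>\<close>, a convex combination of \<open>\<theta>\<close> and \<open>- \<theta>\<close> with weights \<open>l = (1 + \<bar>e z\<bar>) / 2\<close> and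
  \<open>1 - l\<close>. If \<open>u\<close> has value \<open>\<theta>\<close> at \<open>e\<close>, then the vector \<open>v\<close> with \<open>z = l u + (1 - l) v\<close> has value \<open>- \<theta>\<close>,
  and it is in the unit ball exactly if \<open>u\<close> is in the ball around \<open>z / l\<close> of radius \<open>r = (1 - l) / l\<close>.
  So \<open>u\<close> has to be found in the intersection of two balls, both of which contain \<open>z\<close>.
\<close>

lemma cball_subset_closure_hull_face:
  fixes smul :: "'k::real_or_complex \<Rightarrow> 'a::banach \<Rightarrow> 'a"
  assumes B: "banach_space_over smul" and L: "L_summand smul e"
  shows "cball 0 1 \<subseteq> closure (convex hull {x \<in> sphere 0 1. norm (blinfun_apply e x) = 1})"
proof
  fix z :: 'a
  assume "z \<in> cball 0 1"
  then have z: "norm z \<le> 1"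
    by simp
  have e: "norm (blinfun_apply e x) \<le> norm x" for x
    using L by (intro norm_apply_le) (simp add: L_summand_def)
  define F where "F = {x \<in> sphere 0 1. norm (blinfun_apply e x) = 1}"
  have F: "x \<in> F" if "norm x \<le> 1" "norm (blinfun_apply e x) = 1" for x
    using that e [of x] by (simp add: F_def)
  define c where "c = blinfun_apply e z"
  have c1: "norm c \<le> 1"
    using e [of z] z by (simp add: c_def)
  show "z \<in> closure (convex hull F)"
  proof (cases "norm c = 1")
    case True
    then have "z \<in> F"
      using F z by (simp add: c_def)
    then show ?thesis
      by (intro subsetD [OF closure_subset] hull_inc)
  next
    case False
    then have c: "norm c < 1"
      using c1 by simp
    obtain \<theta>' where \<theta>': "norm \<theta>' = 1" "\<theta>' * c = of_real (norm c)"
      using scalar_phase by blast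
    define \<theta> where "\<theta> = inverse \<theta>'"
    have \<theta>: "norm \<theta> = 1" "c = norm c *\<^sub>R \<theta>"
    proof -
      show "norm \<theta> = 1"
        by (simp add: \<theta>_def norm_inverse \<theta>'(1))
      have "\<theta>' \<noteq> 0"
        using \<theta>'(1) by auto
      then have "c = \<theta> * (\<theta>' * c)"
        by (simp add: \<theta>_def flip: mult.assoc)
      then show "c = norm c *\<^sub>R \<theta>"
        unfolding \<theta>'(2) by (simp add: scaleR_conv_of_real mult.commute)
    qed
    define l where "l = (1 + norm c) / 2"
    have l: "0 < l" "l < 1"
      using c by (auto simp: l_def add_pos_nonneg)
    show ?thesis
      unfolding closure_approachable
    proof (intro allI impI)
      fix \<epsilon> :: real
      assume \<epsilon>: "\<epsilon> > 0"
      \<comment> \<open>the corrections of \<open>u\<close> and \<open>v\<close> contribute at most \<open>4 l \<eta>\<close> each\<close>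
      define \<eta> where "\<eta> = \<epsilon> / 16"
      define r where "r = (1 - l) / l"
      have \<eta>: "\<eta> > 0"
        using \<epsilon> by (simp add: \<eta>_def)
      have r: "r > 0" "1 / l = 1 + r"
        using l by (simp_all add: r_def field_simps)
      have cl: "(1 / l) *\<^sub>R c = (1 - r) *\<^sub>R \<theta>"
      proof -
        have "norm c / l = 1 - r"
          using l by (simp add: r_def l_def field_simps)
        then show ?thesis
          by (subst \<theta>(2)) simp
      qed
      obtain u where u: "blinfun_apply e u = \<theta>" "norm (u - 0) < 1 + \<eta>" "norm (u - (1 / l) *\<^sub>R z) < r + \<eta>"
      proof (rule L_summand_replace_coordinate [OF B L _ _ _ _ \<eta>])
        show "norm (\<theta> - blinfun_apply e 0) \<le> 1"
          by (simp add: \<theta>(1) blinfun.zero_right)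
        have "\<theta> - blinfun_apply e ((1 / l) *\<^sub>R z) = r *\<^sub>R \<theta>"
          using cl by (simp add: blinfun.scaleR_right flip: c_def) (simp add: algebra_simps)
        then show "norm (\<theta> - blinfun_apply e ((1 / l) *\<^sub>R z)) \<le> r"
          using \<theta>(1) r by simp
        show "norm (z - 0) \<le> 1"
          using z by simp
        have "z - (1 / l) *\<^sub>R z = - (r *\<^sub>R z)"
          by (simp add: r(2) algebra_simps)
        then show "norm (z - (1 / l) *\<^sub>R z) \<le> r"
          using z r mult_left_mono [OF z, of r] by simp
      qed
      define v where "v = (1 / r) *\<^sub>R ((1 / l) *\<^sub>R z - u)"
      have ev: "blinfun_apply e v = - \<theta>"
      proof -
        have "blinfun_apply e v = (1 / r) *\<^sub>R ((1 / l) *\<^sub>R c - \<theta>)"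
          by (simp add: v_def blinfun.bilinear_simps u(1) c_def)
        also have "(1 / l) *\<^sub>R c - \<theta> = - (r *\<^sub>R \<theta>)"
          unfolding cl by (simp add: algebra_simps)
        finally show ?thesis
          using r by simp
      qed
      have "norm v = norm (u - (1 / l) *\<^sub>R z) / r"
        using r by (simp add: v_def norm_minus_commute)
      also have "\<dots> \<le> (r + \<eta>) / r"
        using r u(3) by (intro divide_right_mono) auto
      finally have nv: "norm v \<le> 1 + \<eta> / r"
        using r by (simp add: add_divide_distrib)
      obtain u' where u': "blinfun_apply e u' = \<theta>" "norm u' \<le> 1" "norm (u' - u) \<le> 4 * \<eta>"
        using L_summand_norm_one_correction [OF B L \<theta>(1) u(1) _ \<eta>] u(2) by auto
      obtain v' where v': "blinfun_apply e v' = - \<theta>" "norm v' \<le> 1" "norm (v' - v) \<le> 4 * (\<eta> / r)"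
        using L_summand_norm_one_correction [OF B L _ ev nv] \<theta>(1) \<eta> r by auto
      have zuv: "z = l *\<^sub>R u + (1 - l) *\<^sub>R v"
      proof -
        have "(1 - l) *\<^sub>R v = l *\<^sub>R ((1 / l) *\<^sub>R z - u)"
          using l r by (simp add: v_def r_def)
        then show ?thesis
          using l by (simp add: algebra_simps)
      qed
      have "norm ((l *\<^sub>R u' + (1 - l) *\<^sub>R v') - z) = norm (l *\<^sub>R (u' - u) + (1 - l) *\<^sub>R (v' - v))"
        unfolding zuv by (simp add: algebra_simps)
      also have "\<dots> \<le> l * (4 * \<eta>) + (1 - l) * (4 * (\<eta> / r))"
        using l mult_left_mono [OF u'(3), of l] mult_left_mono [OF v'(3), of "1 - l"]
        by (intro norm_triangle_le add_mono) simp_all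
      also have "\<dots> = 8 * (l * \<eta>)"
        using l by (simp add: r_def field_simps)
      also have "\<dots> < \<epsilon>"
        using l \<epsilon> mult_strict_right_mono [OF l(2) \<eta>] by (simp add: \<eta>_def)
      finally have "dist (l *\<^sub>R u' + (1 - l) *\<^sub>R v') z < \<epsilon>"
        by (simp add: dist_norm)
      moreover have "u' \<in> F" "v' \<in> F"
        using F u' v' \<theta>(1) by auto
      then have "l *\<^sub>R u' + (1 - l) *\<^sub>R v' \<in> convex hull F"
        using l by (intro convexD [OF convex_convex_hull] hull_inc) auto
      ultimately show "\<exists>y\<in>convex hull F. dist y z < \<epsilon>"
        by blast
    qed
  qed
qed


section \<open>Delta-points\<close>

text \<open>
  The prescribed pair of values is the one that \<open>x\<close> takes after its value at \<open>g\<close> has been changed to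
  \<open>s\<close>. If it were not in the closure of the image of the ball under \<open>(g, f)\<close>, a line in the
  plane over the scalar field would separate them, that is, a combination \<open>k = c g + d f\<close>. Its norm is
  known from the decomposition of \<open>f\<close>, and is too large for that.
\<close>

lemma L_coordinate_approximation:
  fixes smul :: "'k::real_or_complex \<Rightarrow> 'a::banach \<Rightarrow> 'a"
  assumes B: "banach_space_over smul" and g: "g \<in> dual_space smul" and f: "f \<in> dual_space smul"
    and a: "L_coordinate g f a" and x: "norm x \<le> 1" and s: "norm s \<le> 1" and \<delta>: "\<delta> > 0"
  obtains y where "norm y \<le> 1" "norm (blinfun_apply g y - s) < \<delta>"
    "norm (blinfun_apply f y - (a * s + (blinfun_apply f x - a * blinfun_apply g x))) < \<delta>"
proof -
  define h where "h = f - dual_scale a g"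
  define t where "t = a * s + blinfun_apply h x"
  define S where "S = closure ((\<lambda>y. (blinfun_apply g y, blinfun_apply f y)) ` cball 0 1)"
  have "(s, t) \<in> S"
  proof (rule ccontr)
    assume notin: "(s, t) \<notin> S"
    have "convex S"
      unfolding S_def
      by (intro convex_closure convex_linear_image convex_cball linearI)
        (simp_all add: blinfun.bilinear_simps)
    moreover have "closed S"
      by (simp add: S_def)
    ultimately obtain w b where w: "w \<bullet> (s, t) < b" "\<And>p. p \<in> S \<Longrightarrow> b < w \<bullet> p"
      using separating_hyperplane_closed_point [OF _ _ notin] by blast
    obtain c where c: "\<And>z. fst w \<bullet> z = scalar_Re (c * z)"
      using scalar_inner by blast
    obtain d where d: "\<And>z. snd w \<bullet> z = scalar_Re (d * z)"
      using scalar_inner by blast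
    have inner: "w \<bullet> (p, p') = scalar_Re (c * p + d * p')" for p p'
      by (simp add: inner_prod_def c d scalar_Re_add)
    define k where "k = dual_scale c g + dual_scale d f"
    have k: "k \<in> dual_space smul"
      using f g by (simp add: k_def dual_space_add dual_space_scale)
    have "1 * norm k \<le> - b"
    proof (rule dual_norm_bound [OF k])
      fix y :: 'a
      assume y: "norm y \<le> 1"
      obtain y' where y': "norm y' = norm y" "blinfun_apply k y' = of_real (norm (blinfun_apply k y))"
        using dual_Re_attains_norm [OF B k] by blast
      have "(blinfun_apply g (- y'), blinfun_apply f (- y')) \<in> S"
        unfolding S_def using y y'(1) by (intro subsetD [OF closure_subset] imageI) simp
      then have "b < scalar_Re (blinfun_apply k (- y'))"
        using w(2) by (fastforce simp: inner k_def blinfun.add_left)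
      then show "norm (blinfun_apply k y) \<le> - b"
        by (simp add: blinfun.minus_right y' scalar_Re_minus scalar_Re_of_real)
    qed simp
    moreover have "norm k = norm (c + d * a) + norm d * norm h"
    proof -
      have "k = dual_scale (c + d * a) g + dual_scale d h"
        by (rule blinfun_eqI) (simp add: k_def h_def blinfun.bilinear_simps algebra_simps)
      then show ?thesis
        using a by (simp add: L_coordinate_def h_def)
    qed
    moreover have "w \<bullet> (s, t) = scalar_Re ((c + d * a) * s + d * blinfun_apply h x)"
      by (simp add: inner t_def algebra_simps)
    moreover have "norm ((c + d * a) * s + d * blinfun_apply h x) \<le> norm (c + d * a) + norm d * norm h"
    proof (intro norm_triangle_le add_mono)
      show "norm ((c + d * a) * s) \<le> norm (c + d * a)"
        using mult_left_mono [OF s norm_ge_zero [of "c + d * a"]] by (simp add: norm_mult)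
      have "norm (blinfun_apply h x) \<le> norm h"
        using norm_blinfun [of h x] mult_left_mono [OF x norm_ge_zero [of h]] by simp
      then show "norm (d * blinfun_apply h x) \<le> norm d * norm h"
        by (simp add: norm_mult mult_left_mono)
    qed
    ultimately show False
      using w(1) scalar_Re_ge_norm [of "(c + d * a) * s + d * blinfun_apply h x"] by linarith
  qed
  then obtain y where y: "norm y \<le> 1" "dist (blinfun_apply g y, blinfun_apply f y) (s, t) < \<delta>"
    unfolding S_def closure_approachable using \<delta> by fastforce
  have "dist (blinfun_apply g y) s < \<delta>" "dist (blinfun_apply f y) t < \<delta>"
    using y(2) dist_fst_le [of "(blinfun_apply g y, blinfun_apply f y)" "(s, t)"]
      dist_snd_le [of "(blinfun_apply g y, blinfun_apply f y)" "(s, t)"] by auto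
  then show thesis
    using that [OF y(1)] by (simp add: dist_norm t_def h_def blinfun.diff_left)
qed

text \<open>
  The witness is \<open>x\<close> with its value at a suitable \<open>g\<close> changed to the opposite one.
\<close>

lemma Delta_point_if_small_L_coordinates:
  fixes smul :: "'k::real_or_complex \<Rightarrow> 'a::banach \<Rightarrow> 'a"
  assumes B: "banach_space_over smul" and x: "norm x = 1"
    and small: "\<And>f \<delta>. f \<in> dual_space smul \<Longrightarrow> \<delta> > 0 \<Longrightarrow>
      \<exists>g\<in>dual_space smul. \<exists>a. norm g = 1 \<and> L_coordinate g f a \<and> norm a < \<delta> \<and> norm (blinfun_apply g x) > 1 - \<delta>"
  shows "x \<in> Delta_points smul"
  unfolding Delta_points_def
proof (intro CollectI conjI allI impI ballI)
  show "x \<in> sphere 0 1"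
    using x by simp
  fix \<epsilon> :: real and f \<alpha>
  assume \<epsilon>: "\<epsilon> > 0" and f: "f \<in> dual_space smul" and \<alpha>: "\<alpha> > 0" and slice: "x \<in> ball_slice smul f \<alpha>"
  define \<sigma> where "\<sigma> = (SUP z\<in>cball 0 1. scalar_Re (blinfun_apply f z)) - \<alpha>"
  define \<gamma> where "\<gamma> = scalar_Re (blinfun_apply f x) - \<sigma>"
  have \<gamma>: "\<gamma> > 0"
    using slice by (simp add: ball_slice_def \<gamma>_def \<sigma>_def)
  define \<delta> where "\<delta> = min \<gamma> \<epsilon> / 4"
  have \<delta>: "\<delta> > 0" "4 * \<delta> \<le> \<gamma>" "4 * \<delta> \<le> \<epsilon>"
    using \<gamma> \<epsilon> by (auto simp: \<delta>_def)
  obtain g a where g: "g \<in> dual_space smul" "norm g = 1" and a: "L_coordinate g f a" "norm a < \<delta>"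
    and gx: "norm (blinfun_apply g x) > 1 - \<delta>"
    using small [OF f \<delta>(1)] by blast
  have gx1: "norm (blinfun_apply g x) \<le> 1"
    using norm_apply_le [of g x] g x by simp
  obtain y where y: "norm y \<le> 1" "norm (blinfun_apply g y - (- blinfun_apply g x)) < \<delta>"
      "norm (blinfun_apply f y - (a * (- blinfun_apply g x) + (blinfun_apply f x - a * blinfun_apply g x))) < \<delta>"
    using L_coordinate_approximation [OF B g(1) f a(1), of x "- blinfun_apply g x" \<delta>] x gx1 \<delta> by auto
  define p where "p = a * blinfun_apply g x"
  define r where "r = blinfun_apply f y - (a * (- blinfun_apply g x) + (blinfun_apply f x - a * blinfun_apply g x))"
  have "norm p < \<delta>" "norm r < \<delta>"
    using a(2) y(3) mult_left_mono [OF gx1, of "norm a"] by (simp_all add: p_def r_def norm_mult)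
  moreover have eq: "blinfun_apply f x - blinfun_apply f y = (p + p) - r"
    by (simp add: p_def r_def)
  ultimately have "norm (blinfun_apply f x - blinfun_apply f y) < 3 * \<delta>"
    unfolding eq using norm_triangle_ineq [of p p] norm_triangle_ineq4 [of "p + p" r] by linarith
  then have "scalar_Re (blinfun_apply f y) > \<sigma>"
    using scalar_Re_le_norm [of "blinfun_apply f x - blinfun_apply f y"] \<delta>
    unfolding scalar_Re_diff \<gamma>_def by linarith
  then have "y \<in> ball_slice smul f \<alpha>"
    using y(1) by (simp add: ball_slice_def \<sigma>_def)
  moreover have "norm (x - y) > 2 - \<epsilon>"
  proof -
    have "2 * norm (blinfun_apply g x) = norm (2 *\<^sub>R blinfun_apply g x)"
      by simp
    also have "2 *\<^sub>R blinfun_apply g x =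
        blinfun_apply g (x - y) + (blinfun_apply g y - (- blinfun_apply g x))"
      by (simp add: blinfun.diff_right scaleR_2)
    also have "norm \<dots> \<le> norm (blinfun_apply g (x - y)) + \<delta>"
      using y(2) by (intro norm_triangle_le add_left_mono less_imp_le)
    finally have "2 * norm (blinfun_apply g x) \<le> norm (blinfun_apply g (x - y)) + \<delta>" .
    moreover have "norm (blinfun_apply g (x - y)) \<le> norm (x - y)"
      using g by (simp add: norm_apply_le)
    ultimately show ?thesis
      using gx \<delta> by linarith
  qed
  ultimately show "\<exists>y\<in>ball_slice smul f \<alpha>. norm (x - y) > 2 - \<epsilon>"
    by blast
qed


section \<open>Clusters of extreme points in the weak-star topology\<close>

lemma L1_predual_representation:
  assumes "L1_predual smul M"
  obtains T where "L1_representation smul M T"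
proof -
  obtain T where T:
      "\<forall>f\<in>dual_space smul. integrable M (T f)"
      "\<forall>f\<in>dual_space smul. \<forall>g\<in>dual_space smul. AE t in M. T (f + g) t = T f t + T g t"
      "\<forall>c. \<forall>f\<in>dual_space smul. AE t in M. T (dual_scale c f) t = c * T f t"
      "\<forall>f\<in>dual_space smul. (\<integral>t. norm (T f t) \<partial>M) = norm f"
      "\<forall>h. integrable M h \<longrightarrow> (\<exists>f\<in>dual_space smul. AE t in M. T f t = h t)"
    using assms unfolding L1_predual_def by blast
  have "L1_representation smul M T"
    by (rule L1_representation.intro) (use T in blast)+
  then show thesis
    by (rule that)
qed

text \<open>
  Both parts of the theorem are instances of this criterion. It asks for the approximation of \<open>e\<close> at
  one point \<open>x\<close> at a time, and the family \<open>J\<close> may depend on \<open>x\<close>.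
\<close>

lemma convex_DLD2P_if_clustered:
  fixes smul :: "'k::real_or_complex \<Rightarrow> 'a::banach \<Rightarrow> 'a"
  assumes B: "banach_space_over smul" and M: "L1_predual smul M"
    and e: "e \<in> ext_dual_ball smul" "norm e = 1"
    and cluster: "\<And>x \<delta>. norm (blinfun_apply e x) = 1 \<Longrightarrow> 0 < \<delta> \<Longrightarrow>
      \<exists>J\<subseteq>ext_dual_ball smul. infinite J \<and>
        (\<forall>g\<in>J. \<forall>h\<in>J. g \<noteq> h \<longrightarrow> linearly_independent_pair g h) \<and>
        (\<forall>g\<in>J. norm (blinfun_apply g x - blinfun_apply e x) < \<delta>)"
  shows "convex_DLD2P smul"
proof -
  obtain T where "L1_representation smul M T"
    using L1_predual_representation [OF M] by blast
  then interpret L1_representation smul M T .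
  have L: "L_summand smul e"
    unfolding L_summand_def
  proof (intro conjI ballI)
    show "e \<in> dual_space smul" "norm e = 1"
      using e ext_dual_ball_dual by blast+
    show "\<exists>a. L_coordinate e f a" if "f \<in> dual_space smul" for f
      using L_coordinate_exists [OF e that] by blast
  qed
  have Delta: "x \<in> Delta_points smul" if x: "norm x = 1" "norm (blinfun_apply e x) = 1" for x
  proof (rule Delta_point_if_small_L_coordinates [OF B x(1)])
    fix f and \<delta> :: real
    assume f: "f \<in> dual_space smul" and \<delta>: "\<delta> > 0"
    obtain J where J: "J \<subseteq> ext_dual_ball smul" "infinite J"
        "\<forall>g\<in>J. \<forall>h\<in>J. g \<noteq> h \<longrightarrow> linearly_independent_pair g h"
        "\<forall>g\<in>J. norm (blinfun_apply g x - blinfun_apply e x) < \<delta>"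
      using cluster [OF x(2) \<delta>] by (elim exE conjE) (rule that)
    have indep: "linearly_independent_pair g h" if "g \<in> J" "h \<in> J" "g \<noteq> h" for g h
      using J(3) that by blast
    obtain g a where g: "g \<in> J" "norm g = 1" "L_coordinate g f a" "norm a < \<delta>"
      by (rule small_L_coordinate [OF J(1,2) indep f \<delta>])
    have "norm (blinfun_apply g x) > 1 - \<delta>"
      using norm_triangle_sub [of "blinfun_apply e x" "blinfun_apply g x"] bspec [OF J(4) g(1)] x(2)
      by (simp add: norm_minus_commute)
    then show "\<exists>g\<in>dual_space smul. \<exists>a. norm g = 1 \<and> L_coordinate g f a \<and> norm a < \<delta> \<and>
        norm (blinfun_apply g x) > 1 - \<delta>"
      using g J(1) ext_dual_ball_dual by blast
  qed
  have "cball 0 1 \<subseteq> closure (convex hull Delta_points smul)"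
    by (rule order_trans [OF cball_subset_closure_hull_face [OF B L] closure_mono [OF hull_mono]])
      (use Delta in auto)
  moreover have "closure (convex hull Delta_points smul) \<subseteq> cball 0 1"
    by (intro closure_minimal hull_minimal) (auto simp: Delta_points_def)
  ultimately show ?thesis
    by (simp add: convex_DLD2P_def subset_antisym)
qed

lemma openin_weak_star_evaluation:
  assumes "open V"
  shows "openin (weak_star_topology smul) {g \<in> dual_space smul. blinfun_apply g x \<in> V}"
proof -
  have "openin strong_operator_topology {g. blinfun_apply g x \<in> V}"
    using openin_continuous_map_preimage [OF strong_operator_topology_continuous_evaluation [of x], of V] assms
    by (simp add: strong_operator_topology_topspace)
  moreover have "{g \<in> dual_space smul. blinfun_apply g x \<in> V} = dual_space smul \<inter> {g. blinfun_apply g x \<in> V}"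
    by auto
  ultimately show ?thesis
    by (auto simp: weak_star_topology_def openin_subtopology)
qed

lemma topspace_weak_star: "topspace (weak_star_topology smul) = dual_space smul"
  by (simp add: weak_star_topology_def strong_operator_topology_topspace)

lemma t1_space_weak_star: "t1_space (weak_star_topology smul)"
  unfolding t1_space_def topspace_weak_star
proof (intro ballI impI)
  fix f g
  assume fg: "f \<in> dual_space smul" "g \<in> dual_space smul" "f \<noteq> g"
  then obtain x where "blinfun_apply f x \<noteq> blinfun_apply g x"
    using blinfun_eqI by blast
  then show "\<exists>U. openin (weak_star_topology smul) U \<and> f \<in> U \<and> g \<notin> U"
    using fg by (intro exI [of _ "{h \<in> dual_space smul. blinfun_apply h x \<in> - {blinfun_apply g x}}"]
      conjI openin_weak_star_evaluation) auto
qed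

text \<open>
  An upper bound of a finite tail would be a greatest element.
\<close>

lemma infinite_tail:
  assumes "directed_without_greatest I le" "i \<in> I"
  shows "infinite {j\<in>I. le i j}"
proof
  have le_trans: "le i k" if "i \<in> I" "j \<in> I" "k \<in> I" "le i j" "le j k" for i j k
    using assms(1) that unfolding directed_without_greatest_def by metis
  have dir: "\<exists>k\<in>I. le i k \<and> le j k" if "i \<in> I" "j \<in> I" for i j
    using assms(1) that unfolding directed_without_greatest_def by metis
  have bound: "\<exists>m\<in>I. \<forall>j\<in>F. le j m" if "finite F" "F \<subseteq> I" for F
    using that
  proof (induction F rule: finite_induct)
    case empty
    then show ?case
      using assms(2) by blast
  next
    case (insert a F)
    then obtain m where m: "m \<in> I" "\<forall>j\<in>F. le j m"
      by blast
    obtain k where k: "k \<in> I" "le a k" "le m k"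
      using dir [of a m] insert.prems m(1) by blast
    have "le j k" if "j \<in> F" for j
      using le_trans [of j m k] that m k insert.prems by blast
    then show ?case
      using k by blast
  qed
  assume "finite {j\<in>I. le i j}"
  then obtain m where m: "m \<in> I" "\<And>j. j \<in> I \<Longrightarrow> le i j \<Longrightarrow> le j m"
    using bound [of "{j\<in>I. le i j}"] by blast
  have "le j m" if j: "j \<in> I" for j
  proof -
    obtain k where k: "k \<in> I" "le i k" "le j k"
      using dir [OF assms(2) j] by blast
    then show ?thesis
      using le_trans [OF j k(1) m(1) k(3)] m(2) by blast
  qed
  then show False
    using assms(1) m(1) unfolding directed_without_greatest_def by metis
qed

lemma real_linear_dependence:
  fixes g h :: "'a::banach \<Rightarrow>\<^sub>L 'k::real_or_complex"
  assumes real: "(UNIV :: 'k set) = \<real>" and norms: "norm g = 1" "norm h = 1"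
    and dep: "\<not> linearly_independent_pair g h"
  shows "h = g \<or> h = - g"
proof -
  obtain a b where ab: "dual_scale a g + dual_scale b h = 0" "\<not> (a = 0 \<and> b = 0)"
    using dep unfolding linearly_independent_pair_def by blast
  obtain p q where pq: "a = of_real p" "b = of_real q"
    using real by (metis Reals_cases UNIV_I)
  have eq: "q *\<^sub>R h = (- p) *\<^sub>R g"
    using ab(1) by (simp add: pq dual_scale_of_real eq_neg_iff_add_eq_0 add.commute)
  have "\<bar>q\<bar> = \<bar>p\<bar>"
    using arg_cong [OF eq, of norm] norms by simp
  then consider "p = q" "q \<noteq> 0" | "p = - q" "q \<noteq> 0"
    using ab(2) pq by (auto simp: abs_eq_iff)
  then show ?thesis
  proof cases
    case 1
    then have "q *\<^sub>R h = q *\<^sub>R (- g)"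
      using eq by simp
    then show ?thesis
      using 1 by (simp only: scaleR_cancel_left) simp
  next
    case 2
    then have "q *\<^sub>R h = q *\<^sub>R g"
      using eq by simp
    then show ?thesis
      using 2 by (simp only: scaleR_cancel_left) simp
  qed
qed

theorem corollary3p9:
  fixes smul :: "'k::real_or_complex \<Rightarrow> 'a::banach \<Rightarrow> 'a" and M :: "'m measure"
  assumes "banach_space_over smul"
    and "infinite_dimensional smul"
    and "L1_predual smul M"
  shows "((\<exists>estar \<in> ext_dual_ball smul. \<exists>(I :: 'i set) le e.
            directed_without_greatest I le \<and>
            (\<forall>i\<in>I. e i \<in> ext_dual_ball smul) \<and>
            (\<forall>i\<in>I. \<forall>j\<in>I. i \<noteq> j \<longrightarrow> linearly_independent_pair (e i) (e j)) \<and>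
            limitin (weak_star_topology smul) e estar (net_filter I le))
          \<longrightarrow> convex_DLD2P smul)
       \<and> ((UNIV :: 'k set) = \<real> \<longrightarrow>
          (weak_star_topology smul) derived_set_of (ext_dual_ball smul) \<inter> ext_dual_ball smul \<noteq> {}
          \<longrightarrow> convex_DLD2P smul)"
proof (intro conjI impI)
  assume "\<exists>estar \<in> ext_dual_ball smul. \<exists>(I :: 'i set) le e.
            directed_without_greatest I le \<and>
            (\<forall>i\<in>I. e i \<in> ext_dual_ball smul) \<and>
            (\<forall>i\<in>I. \<forall>j\<in>I. i \<noteq> j \<longrightarrow> linearly_independent_pair (e i) (e j)) \<and>
            limitin (weak_star_topology smul) e estar (net_filter I le)"
  then obtain e' and I :: "'i set" and le e where e': "e' \<in> ext_dual_ball smul"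
    and I: "directed_without_greatest I le" and "\<forall>i\<in>I. e i \<in> ext_dual_ball smul"
    and "\<forall>i\<in>I. \<forall>j\<in>I. i \<noteq> j \<longrightarrow> linearly_independent_pair (e i) (e j)"
    and lim: "limitin (weak_star_topology smul) e e' (net_filter I le)"
    by (elim bexE exE conjE) (rule that)
  then have e: "\<And>i. i \<in> I \<Longrightarrow> e i \<in> ext_dual_ball smul"
    and indep: "\<And>i j. i \<in> I \<Longrightarrow> j \<in> I \<Longrightarrow> i \<noteq> j \<Longrightarrow> linearly_independent_pair (e i) (e j)"
    by blast+
  have inj: "inj_on e I"
    using indep linearly_independent_pair_nonzero(2) by (metis inj_onI)
  have ne: "norm e' = 1"
  proof -
    obtain i where i: "i \<in> I"
      using I by (auto simp: directed_without_greatest_def)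
    have "\<exists>j\<in>I. j \<noteq> i"
      using I i unfolding directed_without_greatest_def by metis
    then have "e i \<noteq> 0"
      using indep linearly_independent_pair_nonzero(1) i by metis
    then show ?thesis
      using norm_ext_dual_ball [OF e'] ext_dual_ball_dual [OF e [OF i]] by blast
  qed
  show "convex_DLD2P smul"
  proof (rule convex_DLD2P_if_clustered [OF assms(1,3) e' ne])
    fix x :: 'a and \<delta> :: real
    assume \<delta>: "\<delta> > 0"
    define U where "U = {g \<in> dual_space smul. blinfun_apply g x \<in> ball (blinfun_apply e' x) \<delta>}"
    have "openin (weak_star_topology smul) U"
      unfolding U_def by (rule openin_weak_star_evaluation) (rule open_ball)
    moreover have "e' \<in> U"
      using ext_dual_ball_dual [OF e'] \<delta> by (simp add: U_def)
    ultimately have "eventually (\<lambda>i. e i \<in> U) (net_filter I le)"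
      using lim unfolding limitin_def by blast
    then obtain i where i: "i \<in> I" "\<And>j. j \<in> I \<Longrightarrow> le i j \<Longrightarrow> dist (blinfun_apply e' x) (blinfun_apply (e j) x) < \<delta>"
      unfolding eventually_net_filter [OF I] U_def by auto
    show "\<exists>J\<subseteq>ext_dual_ball smul. infinite J \<and>
        (\<forall>g\<in>J. \<forall>h\<in>J. g \<noteq> h \<longrightarrow> linearly_independent_pair g h) \<and>
        (\<forall>g\<in>J. norm (blinfun_apply g x - blinfun_apply e' x) < \<delta>)"
    proof (intro exI [of _ "e ` {j\<in>I. le i j}"] conjI)
      show "infinite (e ` {j\<in>I. le i j})"
        using infinite_tail [OF I i(1)] inj_on_subset [OF inj, of "{j\<in>I. le i j}"]
        by (auto dest: finite_imageD)
      show "e ` {j\<in>I. le i j} \<subseteq> ext_dual_ball smul"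
        using e by blast
      show "\<forall>g\<in>e ` {j\<in>I. le i j}. \<forall>h\<in>e ` {j\<in>I. le i j}. g \<noteq> h \<longrightarrow> linearly_independent_pair g h"
        using indep by fast
      show "\<forall>g\<in>e ` {j\<in>I. le i j}. norm (blinfun_apply g x - blinfun_apply e' x) < \<delta>"
        using i(2) by (simp add: dist_norm norm_minus_commute)
    qed
  qed
next
  assume real: "(UNIV :: 'k set) = \<real>"
    and "(weak_star_topology smul) derived_set_of (ext_dual_ball smul) \<inter> ext_dual_ball smul \<noteq> {}"
  then obtain e where acc: "e \<in> (weak_star_topology smul) derived_set_of (ext_dual_ball smul)"
    and e: "e \<in> ext_dual_ball smul"
    by blast
  have inf: "infinite (ext_dual_ball smul \<inter> U)" if "openin (weak_star_topology smul) U" "e \<in> U" for U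
    using acc t1_space_weak_star [of smul] that unfolding t1_space_derived_set_of_infinite_openin by blast
  obtain g where g: "g \<in> ext_dual_ball smul" "g \<noteq> 0"
  proof -
    have "infinite (ext_dual_ball smul)"
      using inf [OF openin_topspace] ext_dual_ball_dual [OF e] by (auto simp: topspace_weak_star)
    then have "ext_dual_ball smul - {0} \<noteq> {}"
      by (metis finite.emptyI infinite_remove)
    then show thesis
      using that by blast
  qed
  have norm1: "norm h = 1" if "h \<in> ext_dual_ball smul" for h
    using norm_ext_dual_ball [OF that ext_dual_ball_dual [OF g(1)] g(2)] .
  show "convex_DLD2P smul"
  proof (rule convex_DLD2P_if_clustered [OF assms(1,3) e norm1 [OF e]])
    fix x :: 'a and \<delta> :: real
    assume x: "norm (blinfun_apply e x) = 1" and \<delta>: "\<delta> > 0"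
    \<comment> \<open>the bound \<open>1\<close> rules out that \<open>J\<close> contains both \<open>g\<close> and \<open>- g\<close>\<close>
    define J where "J = ext_dual_ball smul \<inter>
      {g \<in> dual_space smul. blinfun_apply g x \<in> ball (blinfun_apply e x) (min \<delta> 1)}"
    have J: "norm (blinfun_apply g x - blinfun_apply e x) < min \<delta> 1" if "g \<in> J" for g
      using that by (simp add: J_def dist_norm norm_minus_commute)
    have "infinite J"
      unfolding J_def using ext_dual_ball_dual [OF e] \<delta>
      by (intro inf openin_weak_star_evaluation) auto
    moreover have "linearly_independent_pair g h" if "g \<in> J" "h \<in> J" "g \<noteq> h" for g h
    proof (rule ccontr)
      assume "\<not> linearly_independent_pair g h"
      then have "h = - g"
        using real_linear_dependence [OF real, of g h] norm1 that by (auto simp: J_def)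
      then have "norm (blinfun_apply g x - blinfun_apply e x) < 1" "norm (- blinfun_apply g x - blinfun_apply e x) < 1"
        using J [OF that(1)] J [OF that(2)] by (auto simp: blinfun.minus_left)
      then have "norm ((blinfun_apply g x - blinfun_apply e x) + (- blinfun_apply g x - blinfun_apply e x)) < 2"
        by (intro norm_triangle_lt) simp
      moreover have "(blinfun_apply g x - blinfun_apply e x) + (- blinfun_apply g x - blinfun_apply e x) =
          (- 2) *\<^sub>R blinfun_apply e x"
        by (simp add: scaleR_2)
      ultimately show False
        using x by (simp del: scaleR_minus_left)
    qed
    ultimately show "\<exists>J\<subseteq>ext_dual_ball smul. infinite J \<and>
        (\<forall>g\<in>J. \<forall>h\<in>J. g \<noteq> h \<longrightarrow> linearly_independent_pair g h) \<and>
        (\<forall>g\<in>J. norm (blinfun_apply g x - blinfun_apply e x) < \<delta>)"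
      using J by (intro exI [of _ J]) (auto simp: J_def)
  qed
qed

end
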